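(* Let $\mathfrak{m}=(X_1,\dots,X_n)\subset R=K[X_1,\dots,X_n]$, regarded as a graded $R$-module. Then $$\operatorname{Hdepth}_1\mathfrak{m}=\operatorname{Hdepth}_n\mathfrak{m}=\operatorname{Stdepth}_n\mathfrak{m}=\lfloor (n+1)/2\rfloor.$$
   Context: $K$ is a field. Subscript $n$ refers to the multigrading ($\mathbb{Z}^n$-grading, $\deg X_i=e_i$), subscript $1$ to the standard grading ($\deg X_i=1$). A graded retract of $R$ is a graded $K$-subalgebra $S\subseteq R$ with a graded $K$-algebra epimorphism $\pi:R\to S$, $\pi|_S=\mathrm{id}$ (multigraded: generated by a subset of the indeterminates; standard graded: generated by a set of linear forms). A Stanley decomposition of $M$ is a finite family $(S_i,x_i)_{i\in I}$ with $x_i\in M$ homogeneous, $S_i$ a graded retract, $S_i\cap\operatorname{Ann}(x_i)=0$, $M=\bigoplus_iS_ix_i$ as graded $K$-vector spaces. A Hilbert decomposition is a finite family $(S_i,s_i)_{i\in I}$, $s_i$ degrees, $S_i$ graded retracts, with $M\cong\bigoplus_iS_i(-s_i)$ as graded $K$-vector spaces. The depth of a decomposition is $\min_i\dim S_i$; Stdepth (resp. Hdepth) is the maximal depth of a Stanley (resp. Hilbert) decomposition in the respective grading. *)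

theory Defs
  imports "HOL-Library.Poly_Mapping"
begin

text \<open>Polynomials with coefficients in 'k, exponent vectors are nat =>0 nat.
  The variable X_{i+1} of the paper is index i here.\<close>

type_synonym 'k pol = "(nat \<Rightarrow>\<^sub>0 nat) \<Rightarrow>\<^sub>0 'k"

definition Var :: "nat \<Rightarrow> 'k::field pol" where
  "Var i = Poly_Mapping.single (Poly_Mapping.single i 1) 1"

definition const :: "'k \<Rightarrow> 'k::field pol" where
  "const c = Poly_Mapping.single 0 c"

definition polyring :: "nat \<Rightarrow> 'k::field pol set" where
  "polyring n = {p :: 'k pol. \<forall>m \<in> Poly_Mapping.keys p. Poly_Mapping.keys m \<subseteq> {..<n}}"

definition maxid :: "nat \<Rightarrow> 'k::field pol set" where
  "maxid n = {(\<Sum>i<n. Var i * q i) | q. \<forall>i<n. q i \<in> polyring n}"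

definition mdeg :: "(nat \<Rightarrow>\<^sub>0 nat) \<Rightarrow> (nat \<Rightarrow>\<^sub>0 int)" where
  "mdeg m = Poly_Mapping.map int m"

definition tdeg :: "(nat \<Rightarrow>\<^sub>0 nat) \<Rightarrow> int" where
  "tdeg m = int (\<Sum>i\<in>Poly_Mapping.keys m. Poly_Mapping.lookup m i)"

definition hom :: "((nat \<Rightarrow>\<^sub>0 nat) \<Rightarrow> 'g) \<Rightarrow> 'g \<Rightarrow> 'k::field pol \<Rightarrow> bool" where
  "hom deg g p \<longleftrightarrow> (\<forall>m \<in> Poly_Mapping.keys p. deg m = g)"

definition graded_subspace :: "((nat \<Rightarrow>\<^sub>0 nat) \<Rightarrow> 'g) \<Rightarrow> 'k::field pol set \<Rightarrow> bool" where
  "graded_subspace deg V \<longleftrightarrow>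
     (\<forall>p \<in> V. \<exists>G h. finite G \<and> (\<forall>g \<in> G. h g \<in> V \<and> hom deg g (h g)) \<and> p = (\<Sum>g\<in>G. h g))"

definition subalgebra :: "nat \<Rightarrow> 'k::field pol set \<Rightarrow> bool" where
  "subalgebra n S \<longleftrightarrow> S \<subseteq> polyring n \<and> (\<forall>c. const c \<in> S) \<and>
     (\<forall>p \<in> S. \<forall>q \<in> S. p + q \<in> S \<and> p * q \<in> S)"

definition graded_retract :: "((nat \<Rightarrow>\<^sub>0 nat) \<Rightarrow> 'g) \<Rightarrow> nat \<Rightarrow> 'k::field pol set \<Rightarrow> bool" where
  "graded_retract deg n S \<longleftrightarrow> subalgebra n S \<and> graded_subspace deg S \<and>
     (\<exists>\<pi>. (\<forall>p \<in> polyring n. \<pi> p \<in> S) \<and> \<pi> ` polyring n = S \<and>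
          (\<forall>p \<in> polyring n. \<forall>q \<in> polyring n. \<pi> (p + q) = \<pi> p + \<pi> q \<and> \<pi> (p * q) = \<pi> p * \<pi> q) \<and>
          (\<forall>c. \<pi> (const c) = const c) \<and>
          (\<forall>p \<in> polyring n. \<forall>g. hom deg g p \<longrightarrow> hom deg g (\<pi> p)) \<and>
          (\<forall>p \<in> S. \<pi> p = p))"

definition ideal_in :: "'k::field pol set \<Rightarrow> 'k pol set \<Rightarrow> bool" where
  "ideal_in S I \<longleftrightarrow> I \<subseteq> S \<and> 0 \<in> I \<and> (\<forall>a \<in> I. \<forall>b \<in> I. a + b \<in> I) \<and>
     (\<forall>s \<in> S. \<forall>a \<in> I. s * a \<in> I)"

definition prime_in :: "'k::field pol set \<Rightarrow> 'k pol set \<Rightarrow> bool" where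
  "prime_in S P \<longleftrightarrow> ideal_in S P \<and> P \<noteq> S \<and>
     (\<forall>a \<in> S. \<forall>b \<in> S. a * b \<in> P \<longrightarrow> a \<in> P \<or> b \<in> P)"

definition krull_dim :: "'k::field pol set \<Rightarrow> nat" where
  "krull_dim S = Sup {d. \<exists>P. (\<forall>i\<le>d. prime_in S (P i)) \<and> (\<forall>i<d. P i \<subset> P (Suc i))}"

definition ann :: "nat \<Rightarrow> 'k::field pol \<Rightarrow> 'k pol set" where
  "ann n x = {r \<in> polyring n. r * x = 0}"

definition stanley_dec :: "nat \<Rightarrow> 'k::field pol set \<Rightarrow> ('k pol set \<times> 'k pol) list \<Rightarrow> bool" where
  "stanley_dec n M D \<longleftrightarrow>
     (\<forall>i < length D. graded_retract mdeg n (fst (D!i)) \<and> snd (D!i) \<in> M \<and>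
         (\<exists>g. hom mdeg g (snd (D!i))) \<and> fst (D!i) \<inter> ann n (snd (D!i)) = {0}) \<and>
     M = {(\<Sum>i<length D. f i * snd (D!i)) | f. \<forall>i<length D. f i \<in> fst (D!i)} \<and>
     (\<forall>f h. (\<forall>i<length D. f i \<in> fst (D!i) \<and> h i \<in> fst (D!i)) \<longrightarrow>
        (\<Sum>i<length D. f i * snd (D!i)) = (\<Sum>i<length D. h i * snd (D!i)) \<longrightarrow>
        (\<forall>i<length D. f i * snd (D!i) = h i * snd (D!i)))"

text \<open>Hilbert decomposition w.r.t. grading deg with admissible shifts G:
  M is isomorphic as a graded K-vector space to the external direct sum of the S_i(-s_i).
  Elements of the direct sum are tuples f with f i in S_i (f i = 0 for i outside the index set);
  the degree-g component consists of tuples with f i homogeneous of degree g - s_i.\<close>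
definition hilbert_dec :: "((nat \<Rightarrow>\<^sub>0 nat) \<Rightarrow> 'g::ab_group_add) \<Rightarrow> 'g set \<Rightarrow> nat \<Rightarrow> 'k::field pol set
     \<Rightarrow> ('k pol set \<times> 'g) list \<Rightarrow> bool" where
  "hilbert_dec deg G n M D \<longleftrightarrow>
     (\<forall>i < length D. graded_retract deg n (fst (D!i)) \<and> snd (D!i) \<in> G) \<and>
     (let DS = {f. (\<forall>i<length D. f i \<in> fst (D!i)) \<and> (\<forall>i\<ge>length D. f i = 0)} in
      \<exists>\<phi>. bij_betw \<phi> DS M \<and>
        (\<forall>f \<in> DS. \<forall>h \<in> DS. \<phi> (\<lambda>i. f i + h i) = \<phi> f + \<phi> h) \<and>
        (\<forall>f \<in> DS. \<forall>c. \<phi> (\<lambda>i. const c * f i) = const c * \<phi> f) \<and>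
        (\<forall>f \<in> DS. \<forall>g. (\<forall>i<length D. hom deg (g - snd (D!i)) (f i)) \<longrightarrow> hom deg g (\<phi> f)))"

definition dec_depth :: "('a set \<times> 'b) list \<Rightarrow> ('a set \<Rightarrow> nat) \<Rightarrow> nat" where
  "dec_depth D dim = Min ((\<lambda>x. dim (fst x)) ` set D)"

definition Stdepth_n :: "nat \<Rightarrow> 'k::field pol set \<Rightarrow> nat" where
  "Stdepth_n n M = Sup {dec_depth D krull_dim | D. stanley_dec n M D \<and> D \<noteq> []}"

definition Hdepth_n :: "nat \<Rightarrow> 'k::field pol set \<Rightarrow> nat" where
  "Hdepth_n n M = Sup {dec_depth D krull_dim | D.
      hilbert_dec mdeg {s. Poly_Mapping.keys s \<subseteq> {..<n}} n M D \<and> D \<noteq> []}"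

definition Hdepth_1 :: "nat \<Rightarrow> 'k::field pol set \<Rightarrow> nat" where
  "Hdepth_1 n M = Sup {dec_depth D krull_dim | D. hilbert_dec tdeg UNIV n M D \<and> D \<noteq> []}"

end

theory Submission
  imports Defs Complex_Main "HOL-Library.FuncSet"
begin

text \<open>Lower bound. Place the \<open>n = 2 k + 1\<close> indices and their antipodes on a circle. A nonempty set
  \<open>C\<close> of indices decomposes into runs that no antipode of \<open>C\<close> interrupts; if \<open>A\<close> is the set of
  first elements of the runs, the sets with the same \<open>A\<close> form an interval \<open>[A, B]\<close> with
  \<open>2 |B| = n + |A|\<close>. These intervals partition the nonempty subsets, and for even \<open>n\<close> the interval of
  all sets containing the last index is added. The monomials with support in \<open>[A, B]\<close> are those of
  \<open>x\<^sup>A K[X\<^sub>j : j \<in> B]\<close>, which yields a Stanley decomposition.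

  Upper bound. In the standard grading, \<open>\<mm>\<close> has dimension \<open>n\<close> in degree 1 and \<open>n (n + 1) / 2\<close> in
  degree 2. A Hilbert decomposition of depth \<open>d\<close> therefore has \<open>n\<close> summands generated in degree 1,
  each contributing at least \<open>d\<close> dimensions in degree 2, so \<open>n d \<le> n (n + 1) / 2\<close>. This uses that the
  Krull dimension of a retract is at most the number \<open>r\<close> of its independent linear forms: a longer
  chain of primes would give \<open>r + 1\<close> algebraically independent elements in an algebra with \<open>r\<close>
  generators, contradicting a count of monomials of bounded degree.\<close>

section \<open>Interval partitions of the nonempty subsets\<close>

text \<open>On the circle cut open, indices and antipodes alternate, so the parity of a position says which
  of the two it is. The start value in \<open>phase\<close> makes the sequence wrap around with a change of
  parity, since a half turn exchanges indices and antipodes.\<close>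

primrec last_parity :: "bool \<Rightarrow> nat set \<Rightarrow> nat \<Rightarrow> bool" where
  "last_parity s A 0 = s"
| "last_parity s A (Suc x) = (if x \<in> A then even x else last_parity s A x)"

definition phase :: "nat \<Rightarrow> nat set \<Rightarrow> nat \<Rightarrow> bool" where
  "phase n A = last_parity (\<not> last_parity True A n) A"

text \<open>The condition says that the marked position preceding \<open>c\<close> on the circle has
  the other parity, so that \<open>c\<close> starts a new run.\<close>

definition run_heads :: "nat \<Rightarrow> nat set \<Rightarrow> nat set" where
  "run_heads n C = {c \<in> C. phase n C c = odd c}"

text \<open>The added positions share the parity of the last element of \<open>A\<close> before
  them; inserting them prolongs runs and starts none.\<close>

definition run_hull :: "nat \<Rightarrow> nat set \<Rightarrow> nat set" where
  "run_hull n A = A \<union> {c. c < n \<and> phase n A c = even c}"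

text \<open>The first element of \<open>A\<close> that is met overwrites the start value.\<close>

lemma last_parity_start_irrelevant:
  assumes "A \<noteq> {}" "A \<subseteq> {..<n}"
  shows "last_parity s A n = last_parity s' A n"
proof -
  have "A \<inter> {..<n} \<noteq> {} \<Longrightarrow> last_parity s A n = last_parity s' A n"
  proof (induction n)
    case (Suc n)
    then show ?case by (auto simp: lessThan_Suc)
  qed simp
  then show ?thesis using assms by blast
qed

text \<open>An element of \<open>C - A\<close> whose parity equals the value already stored changes
  nothing when it is met. The disjunction lets that value be known along \<open>A\<close> or along
  \<open>C\<close>: enlarging a set of heads uses the former, passing from a set to its heads the
  latter.\<close>

lemma last_parity_cong:
  assumes "A \<subseteq> C" "\<And>c. c \<in> C - A \<Longrightarrow> last_parity s A c = even c \<or> last_parity s C c = even c"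
  shows "last_parity s A x = last_parity s C x"
proof (induction x)
  case (Suc x)
  then show ?case using assms(1) assms(2)[of x] by auto
qed simp

lemma last_parity_empty [simp]: "last_parity s {} x = s"
  by (induction x) auto

text \<open>The start value of \<open>phase\<close> is characterized as the one that a pass over all
  \<open>n\<close> positions negates. In this form, with \<open>phase_start\<close> as converse, it
  transfers between sets with equal \<open>last_parity\<close>.\<close>

lemma phase_eqI:
  assumes "A \<noteq> {}" "A \<subseteq> {..<n}" "last_parity s A n = (\<not> s)"
  shows "phase n A = last_parity s A"
  using last_parity_start_irrelevant[OF assms(1,2), of True s] assms(3)
  by (simp add: phase_def)

lemma phase_start:
  assumes "A \<noteq> {}" "A \<subseteq> {..<n}"
  obtains s where "phase n A = last_parity s A" "last_parity s A n = (\<not> s)"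
proof
  let ?s = "\<not> last_parity True A n"
  show "phase n A = last_parity ?s A" by (simp add: phase_def)
  show "last_parity ?s A n = (\<not> ?s)"
    using last_parity_start_irrelevant[OF assms, of True ?s] by simp
qed

text \<open>A non-head has the parity of its predecessor, so dropping it does not alter the stored
  value. Without any head the value would stay constant, whereas a pass over all positions has to
  negate it.\<close>

lemma phase_run_heads:
  assumes "C \<noteq> {}" "C \<subseteq> {..<n}"
  shows "run_heads n C \<noteq> {}" "phase n (run_heads n C) = phase n C"
proof -
  let ?A = "run_heads n C"
  obtain s where s: "phase n C = last_parity s C" "last_parity s C n = (\<not> s)"
    using phase_start[OF assms] .
  have eq: "last_parity s ?A x = last_parity s C x" for x
    by (rule last_parity_cong) (auto simp: run_heads_def s)
  show ne: "?A \<noteq> {}"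
  proof
    assume "?A = {}"
    then have "last_parity s ?A n = s" by simp
    then show False using eq[of n] s(2) by simp
  qed
  have "phase n ?A = last_parity s ?A"
    by (rule phase_eqI[OF ne]) (use assms s eq in \<open>auto simp: run_heads_def\<close>)
  then show "phase n ?A = phase n C" using s eq by auto
qed

lemma run_heads_idem:
  assumes "C \<noteq> {}" "C \<subseteq> {..<n}"
  shows "run_heads n (run_heads n C) = run_heads n C"
  using phase_run_heads(2)[OF assms] by (auto simp: run_heads_def)

lemma subset_run_hull_heads:
  assumes "C \<noteq> {}" "C \<subseteq> {..<n}"
  shows "C \<subseteq> run_hull n (run_heads n C)"
  using phase_run_heads(2)[OF assms] assms(2) by (auto simp: run_hull_def run_heads_def)

text \<open>Elements of the hull repeat the parity stored when they are met, so they change neither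
  the phase nor the heads. Together with \<open>subset_run_hull_heads\<close> this shows that the
  fibres of \<open>run_heads\<close> are whole intervals.\<close>

lemma run_heads_eqI:
  assumes "A \<noteq> {}" "A \<subseteq> {..<n}" "run_heads n A = A" "A \<subseteq> C" "C \<subseteq> run_hull n A"
  shows "run_heads n C = A"
proof -
  obtain s where s: "phase n A = last_parity s A" "last_parity s A n = (\<not> s)"
    using phase_start[OF assms(1,2)] .
  have eq: "last_parity s A x = last_parity s C x" for x
    by (rule last_parity_cong) (use assms in \<open>auto simp: run_hull_def s\<close>)
  have "phase n C = last_parity s C"
    by (rule phase_eqI) (use assms s eq in \<open>auto simp: run_hull_def\<close>)
  then have "phase n C = phase n A" using s eq by auto
  then show ?thesis using assms by (auto simp: run_heads_def run_hull_def)
qed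

text \<open>Between two consecutive run heads the gap has even length, and its elements alternately
  fail and satisfy the membership condition of the hull; so exactly half of the complement of
  \<open>A\<close> joins the hull.\<close>

lemma card_run_hull:
  assumes "odd n" "A \<noteq> {}" "A \<subseteq> {..<n}" "run_heads n A = A"
  shows "2 * card (run_hull n A) = n + card A"
proof -
  obtain s where s: "phase n A = last_parity s A" "last_parity s A n = (\<not> s)"
    using phase_start[OF assms(2,3)] .
  have odd: "last_parity s A c = odd c" if "c \<in> A" for c
    using assms(4) that s by (auto simp: run_heads_def)
  define w :: "nat \<Rightarrow> int" where
    "w c = (if c \<in> A then 0 else if last_parity s A c = even c then 1 else - 1)" for c
  \<comment> \<open>Telescoping: off \<open>A\<close> the stored value stays while the parity of the
    position flips, so the indicator changes by \<open>- w t\<close>; at an element of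
    \<open>A\<close> it vanishes before and after.\<close>
  have inv: "(\<Sum>c<t. w c) + of_bool (last_parity s A t = even t) = of_bool s" for t
  proof (induction t)
    case (Suc t)
    then show ?case using odd[of t] by (auto simp: w_def split: if_splits)
  qed simp
  define G where "G = {c. c < n \<and> last_parity s A c = even c}"
  define H where "H = {c. c < n \<and> c \<notin> A \<and> last_parity s A c = odd c}"
  have fin: "finite A" "finite G" "finite H"
    using assms(3) finite_subset by (auto simp: G_def H_def)
  have disj: "A \<inter> G = {}" "A \<inter> H = {}" "G \<inter> H = {}"
    using odd by (auto simp: G_def H_def)
  have un: "{..<n} = A \<union> G \<union> H" using assms(3) by (auto simp: G_def H_def)
  \<comment> \<open>Here \<open>n\<close> must be odd: over all \<open>n\<close> positions both the
    stored value and the parity of the position are negated, so the indicator returns to its initial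
    value.\<close>
  have "(\<Sum>c<n. w c) = 0" using inv[of n] s(2) assms(1) by auto
  moreover have "(\<Sum>c<n. w c) = sum w A + sum w G + sum w H"
    unfolding un using fin disj by (simp add: sum.union_disjoint Int_Un_distrib2)
  moreover have "sum w A = 0" by (simp add: w_def)
  moreover have "sum w G = (\<Sum>c\<in>G. 1)" by (rule sum.cong) (use disj in \<open>auto simp: w_def G_def\<close>)
  moreover have "sum w H = (\<Sum>c\<in>H. -1)" by (rule sum.cong) (auto simp: w_def H_def)
  ultimately have "card G = card H" by simp
  moreover have "card {..<n} = card A + card G + card H"
    unfolding un using fin disj by (simp add: card_Un_disjoint Int_Un_distrib2)
  moreover have "run_hull n A = A \<union> G" by (auto simp: run_hull_def G_def s)
  then have "card (run_hull n A) = card A + card G"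
    using fin disj by (simp add: card_Un_disjoint)
  ultimately show ?thesis by simp
qed

text \<open>The lower ends are the nonempty fixed points of \<open>run_heads\<close>, the upper ends
  their hulls; a set lies only in the interval of its own heads. Since \<open>card A\<close> is
  positive, \<open>2 * card B = n + card A\<close> gives the size bound.\<close>

lemma interval_partition_odd:
  assumes "odd n"
  obtains F where "finite F"
    "\<And>A B. (A, B) \<in> F \<Longrightarrow> A \<noteq> {} \<and> A \<subseteq> B \<and> B \<subseteq> {..<n} \<and> (n + 1) div 2 \<le> card B"
    "\<And>C. C \<subseteq> {..<n} \<Longrightarrow> C \<noteq> {} \<Longrightarrow> \<exists>!I. I \<in> F \<and> fst I \<subseteq> C \<and> C \<subseteq> snd I"
proof
  let ?\<A> = "{A \<in> Pow {..<n}. A \<noteq> {} \<and> run_heads n A = A}"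
  let ?F = "(\<lambda>A. (A, run_hull n A)) ` ?\<A>"
  show "finite ?F" by auto
  show "A \<noteq> {} \<and> A \<subseteq> B \<and> B \<subseteq> {..<n} \<and> (n + 1) div 2 \<le> card B" if "(A, B) \<in> ?F" for A B
  proof -
    have A: "A \<noteq> {}" "A \<subseteq> {..<n}" "run_heads n A = A" "B = run_hull n A" using that by auto
    then have "card A > 0" using finite_subset by (auto simp: card_gt_0_iff)
    then show ?thesis using card_run_hull[OF assms A(1-3)] A by (auto simp: run_hull_def)
  qed
  show "\<exists>!I. I \<in> ?F \<and> fst I \<subseteq> C \<and> C \<subseteq> snd I" if C: "C \<subseteq> {..<n}" "C \<noteq> {}" for C
  proof (rule ex1I[of _ "(run_heads n C, run_hull n (run_heads n C))"])
    have "run_heads n C \<subseteq> C" by (auto simp: run_heads_def)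
    then show "(run_heads n C, run_hull n (run_heads n C)) \<in> ?F \<and>
        fst (run_heads n C, run_hull n (run_heads n C)) \<subseteq> C \<and>
        C \<subseteq> snd (run_heads n C, run_hull n (run_heads n C))"
      using C phase_run_heads(1)[of C n] run_heads_idem[of C n] subset_run_hull_heads[of C n]
      by auto
    show "I = (run_heads n C, run_hull n (run_heads n C))"
      if I: "I \<in> ?F \<and> fst I \<subseteq> C \<and> C \<subseteq> snd I" for I
    proof -
      obtain A where A: "A \<in> ?\<A>" "I = (A, run_hull n A)" using I by blast
      then have "run_heads n C = A" using I run_heads_eqI[of A n C] by auto
      then show ?thesis using A by simp
    qed
  qed
qed

lemma interval_partition:
  assumes "n \<ge> 1"
  obtains F where "finite F"
    "\<And>A B. (A, B) \<in> F \<Longrightarrow> A \<noteq> {} \<and> A \<subseteq> B \<and> B \<subseteq> {..<n} \<and> (n + 1) div 2 \<le> card B"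
    "\<And>C. C \<subseteq> {..<n} \<Longrightarrow> C \<noteq> {} \<Longrightarrow> \<exists>!I. I \<in> F \<and> fst I \<subseteq> C \<and> C \<subseteq> snd I"
proof (cases "odd n")
  case True
  then show ?thesis using interval_partition_odd that by blast
next
  case False
  then obtain l where n: "n = Suc l" and l: "odd l" using assms by (cases n) auto
  obtain F where fin: "finite F"
    and F: "\<And>A B. (A, B) \<in> F \<Longrightarrow> A \<noteq> {} \<and> A \<subseteq> B \<and> B \<subseteq> {..<l} \<and> (l + 1) div 2 \<le> card B"
    and ex: "\<And>C. C \<subseteq> {..<l} \<Longrightarrow> C \<noteq> {} \<Longrightarrow> \<exists>!I. I \<in> F \<and> fst I \<subseteq> C \<and> C \<subseteq> snd I"
    using interval_partition_odd[OF l] by blast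
  let ?F = "insert ({l}, {..<n}) F"
  show ?thesis
  proof (rule that[of ?F])
    show "finite ?F" using fin by simp
    show "A \<noteq> {} \<and> A \<subseteq> B \<and> B \<subseteq> {..<n} \<and> (n + 1) div 2 \<le> card B"
      if "(A, B) \<in> ?F" for A B
    proof (cases "(A, B) \<in> F")
      case True
      \<comment> \<open>For odd \<open>l\<close> the additional index does not raise the rounded
        half, so the intervals for \<open>l\<close> are already large enough.\<close>
      have "(n + 1) div 2 = (l + 1) div 2" using n l by (auto elim!: oddE)
      then show ?thesis using F[OF True] n by (auto simp: lessThan_Suc)
    next
      case False
      then show ?thesis using that n by auto
    qed
    show "\<exists>!I. I \<in> ?F \<and> fst I \<subseteq> C \<and> C \<subseteq> snd I" if C: "C \<subseteq> {..<n}" "C \<noteq> {}" for C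
    proof (cases "l \<in> C")
      case True
      show ?thesis
      proof (rule ex1I[of _ "({l}, {..<n})"])
        show "({l}, {..<n}) \<in> ?F \<and> fst ({l}, {..<n}) \<subseteq> C \<and> C \<subseteq> snd ({l}, {..<n})"
          using True C by auto
        show "I = ({l}, {..<n})" if "I \<in> ?F \<and> fst I \<subseteq> C \<and> C \<subseteq> snd I" for I
        proof (rule ccontr)
          assume "I \<noteq> ({l}, {..<n})"
          then have "I \<in> F" using that by auto
          then have "snd I \<subseteq> {..<l}" using F[of "fst I" "snd I"] by auto
          then show False using that True by auto
        qed
      qed
    next
      case False
      then have "C \<subseteq> {..<l}" using C n by (auto simp: lessThan_Suc)
      then obtain I where I: "I \<in> F" "fst I \<subseteq> C" "C \<subseteq> snd I"
        and uniq: "\<And>J. J \<in> F \<and> fst J \<subseteq> C \<and> C \<subseteq> snd J \<Longrightarrow> J = I"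
        using ex[of C] C by blast
      show ?thesis
      proof (rule ex1I[of _ I])
        show "I \<in> ?F \<and> fst I \<subseteq> C \<and> C \<subseteq> snd I" using I by simp
        show "J = I" if "J \<in> ?F \<and> fst J \<subseteq> C \<and> C \<subseteq> snd J" for J
          using that False uniq[of J] by auto
      qed
    qed
  qed
qed

section \<open>Polynomials as a vector space\<close>

abbreviation "keys \<equiv> Poly_Mapping.keys"
abbreviation "lookup \<equiv> Poly_Mapping.lookup"
abbreviation "single \<equiv> Poly_Mapping.single"

text \<open>The projection onto the span of selected monomials serves for homogeneous components,
  for setting variables to zero, and for the blocks of the Stanley decomposition.\<close>

lift_definition restr :: "('a \<Rightarrow> bool) \<Rightarrow> ('a \<Rightarrow>\<^sub>0 'b) \<Rightarrow> 'a \<Rightarrow>\<^sub>0 'b::zero"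
  is "\<lambda>P f x. if P x then f x else 0"
  by (rule finite_subset) auto

lemma lookup_restr: "lookup (restr P p) m = (if P m then lookup p m else 0)"
  by transfer simp

lemma keys_restr: "keys (restr P p) = {m \<in> keys p. P m}"
  by (auto simp: in_keys_iff lookup_restr split: if_splits)

lemma restr_0 [simp]: "restr P 0 = 0"
  by (rule poly_mapping_eqI) (simp add: lookup_restr)

lemma restr_add: "restr P (p + q) = restr P p + restr P (q :: 'a \<Rightarrow>\<^sub>0 'b::monoid_add)"
  by (rule poly_mapping_eqI) (simp add: lookup_restr lookup_add)

lemma restr_sum: "restr P (sum f X) = (\<Sum>x\<in>X. restr P (f x :: 'a \<Rightarrow>\<^sub>0 'b::comm_monoid_add))"
  by (induction X rule: infinite_finite_induct) (auto simp: restr_add)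

lemma restr_id: "(\<And>m. m \<in> keys p \<Longrightarrow> P m) \<Longrightarrow> restr P p = p"
  by (rule poly_mapping_eqI) (auto simp: lookup_restr in_keys_iff)

lemma restr_eq_0: "(\<And>m. m \<in> keys p \<Longrightarrow> \<not> P m) \<Longrightarrow> restr P p = 0"
  by (rule poly_mapping_eqI) (auto simp: lookup_restr in_keys_iff)

lemma restr_split: "p = restr P p + restr (\<lambda>m. \<not> P m) (p :: 'a \<Rightarrow>\<^sub>0 'b::monoid_add)"
  by (rule poly_mapping_eqI) (auto simp: lookup_restr lookup_add)

lemma keys_nat_add: "keys (m + m' :: 'a \<Rightarrow>\<^sub>0 nat) = keys m \<union> keys m'"
  by (auto simp: in_keys_iff lookup_add)

lemma keys_sumD: "m \<in> keys (\<Sum>x\<in>X. f x :: 'a \<Rightarrow>\<^sub>0 'b::comm_monoid_add) \<Longrightarrow> \<exists>x\<in>X. m \<in> keys (f x)"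
proof (rule ccontr)
  assume m: "m \<in> keys (\<Sum>x\<in>X. f x)" and "\<not> (\<exists>x\<in>X. m \<in> keys (f x))"
  then have "(\<Sum>x\<in>X. lookup (f x) m) = 0" by (intro sum.neutral) (auto simp: in_keys_iff)
  then show False using m by (simp add: in_keys_iff lookup_sum)
qed

lemma keys_multD: "m \<in> keys (p * q) \<Longrightarrow> \<exists>a\<in>keys p. \<exists>b\<in>keys q. m = a + b"
  using keys_mult[of p q] by blast

lemma monomial_expansion: "p = (\<Sum>m\<in>keys p. single m (lookup p m))"
  by (rule poly_mapping_eqI)
    (auto simp: lookup_sum lookup_single when_def in_keys_iff sum.delta' intro!: sum.neutral)

lemma const_0 [simp]: "const 0 = 0" and const_1 [simp]: "const 1 = 1"
  by (simp_all add: const_def)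

lemma const_add: "const (a + b) = const a + const b"
  by (simp add: const_def single_add)

lemma const_mult: "const (a * b) = const a * const b"
  by (simp add: const_def mult_single)

lemma lookup_const_mult: "lookup (const c * p) m = c * lookup p m"
proof -
  have "lookup (Poly_Mapping.map ((*) c) p) m = c * lookup p m"
    by transfer (simp add: when_def)
  then show ?thesis by (simp add: const_def mult_map_scale_conv_mult)
qed

lemma const_mult_single: "const c * single m a = single m (c * a)"
  by (simp add: const_def mult_single)

lemma keys_const: "keys (const c) \<subseteq> {0}"
  by (simp add: const_def)

global_interpretation pol: vector_space "\<lambda>c (p :: 'k::field pol). const c * p"
  by unfold_locales (simp_all add: algebra_simps const_add const_mult)

text \<open>Independence is stated for a family, so that injectivity comes out of it: equal vectors
  at two indices would satisfy the relation with coefficients 1 and -1. All dimension counts below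
  use this form.\<close>

lemma card_le_if_independent_family:
  fixes v :: "'j \<Rightarrow> 'k::field pol"
  assumes J: "finite J" and T: "finite T" and sub: "v ` J \<subseteq> pol.span T"
    and ind: "\<And>u. (\<Sum>j\<in>J. const (u j) * v j) = 0 \<Longrightarrow> \<forall>j\<in>J. u j = 0"
  shows "card J \<le> card T"
proof -
  have inj: "inj_on v J"
  proof (rule inj_onI, rule ccontr)
    fix a b assume ab: "a \<in> J" "b \<in> J" "v a = v b" "a \<noteq> b"
    let ?u = "\<lambda>j. if j = a then 1 else if j = b then - 1 else (0::'k)"
    have m1: "const (- 1 :: 'k) = - 1" by (simp add: const_def single_uminus)
    have "(\<Sum>j\<in>J. const (?u j) * v j) = (\<Sum>j\<in>{a, b}. const (?u j) * v j)"
      using ab J by (intro sum.mono_neutral_right) auto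
    also have "\<dots> = 0" using ab by (simp add: m1)
    finally show False using ind ab(1) by fastforce
  qed
  have "\<not> pol.dependent (v ` J)"
  proof
    assume "pol.dependent (v ` J)"
    then obtain u where u: "\<exists>x\<in>v ` J. u x \<noteq> 0" "(\<Sum>x\<in>v ` J. const (u x) * x) = 0"
      using pol.dependent_finite[of "v ` J"] J by auto
    then have "(\<Sum>j\<in>J. const (u (v j)) * v j) = 0"
      using sum.reindex[OF inj, of "\<lambda>x. const (u x) * x"] by simp
    then show False using ind[of "\<lambda>j. u (v j)"] u(1) by auto
  qed
  then have "card (v ` J) \<le> card T" using pol.independent_span_bound[OF T _ sub] by auto
  then show ?thesis using card_image[OF inj] by simp
qed

lemma span_monomials:
  assumes "keys p \<subseteq> X"
  shows "p \<in> pol.span ((\<lambda>m. single m 1) ` X)"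
proof -
  have "(\<Sum>m\<in>keys p. const (lookup p m) * single m 1) \<in> pol.span ((\<lambda>m. single m 1) ` X)"
    using assms by (intro pol.span_sum pol.span_scale pol.span_base) auto
  then show ?thesis using monomial_expansion[of p] by (simp add: const_mult_single)
qed

section \<open>Subrings generated by variables, and the maximal ideal\<close>

definition varring :: "nat set \<Rightarrow> 'k::field pol set" where
  "varring A = {p. \<forall>m\<in>keys p. keys m \<subseteq> A}"

lemma polyring_eq_varring: "polyring n = varring {..<n}"
  by (simp add: polyring_def varring_def)

lemma const_in_varring: "const c \<in> varring A"
  using keys_const by (fastforce simp: varring_def)

lemma zero_in_varring: "0 \<in> varring A"
  and one_in_varring: "1 \<in> varring A"
  by (auto simp: varring_def)

lemma add_in_varring: "p \<in> varring A \<Longrightarrow> q \<in> varring A \<Longrightarrow> p + q \<in> varring A"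
  using keys_add by (fastforce simp: varring_def)

lemma sum_in_varring: "(\<And>x. x \<in> X \<Longrightarrow> f x \<in> varring A) \<Longrightarrow> sum f X \<in> varring A"
  by (induction X rule: infinite_finite_induct) (auto simp: zero_in_varring add_in_varring)

lemma mult_in_varring: "p \<in> varring A \<Longrightarrow> q \<in> varring A \<Longrightarrow> p * q \<in> varring A"
  by (fastforce simp: varring_def keys_nat_add dest: keys_multD)

lemma Var_in_varring: "i \<in> A \<Longrightarrow> Var i \<in> varring A"
  by (simp add: varring_def Var_def)

lemma single_in_varring: "keys m \<subseteq> A \<Longrightarrow> single m c \<in> varring A"
  by (simp add: varring_def)

text \<open>This is the substitution of 0 for all variables outside \<open>A\<close>.\<close>

definition supp_restr :: "nat set \<Rightarrow> 'k::field pol \<Rightarrow> 'k pol" where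
  "supp_restr A = restr (\<lambda>m. keys m \<subseteq> A)"

text \<open>The support of a product of monomials is the union of the supports. A product with one
  factor not supported in \<open>A\<close> is therefore not supported in \<open>A\<close>, and only
  the product of the two restrictions survives.\<close>

lemma supp_restr_mult: "supp_restr A (p * q) = supp_restr A p * supp_restr A q"
proof -
  let ?P = "\<lambda>m :: nat \<Rightarrow>\<^sub>0 nat. keys m \<subseteq> A"
  let ?p = "restr ?P p" and ?q = "restr ?P q"
  let ?p' = "restr (\<lambda>m. \<not> ?P m) p" and ?q' = "restr (\<lambda>m. \<not> ?P m) q"
  have "p * q = ?p * q + ?p' * q"
    using arg_cong[OF restr_split[of p ?P], of "\<lambda>x. x * q"] unfolding distrib_right .
  also have "?p * q = ?p * ?q + ?p * ?q'"
    using arg_cong[OF restr_split[of q ?P], of "\<lambda>x. ?p * x"] unfolding distrib_left .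
  finally have "restr ?P (p * q) = restr ?P (?p * ?q) + restr ?P (?p * ?q') + restr ?P (?p' * q)"
    by (simp add: restr_add)
  moreover have "restr ?P (?p' * q) = 0"
    by (rule restr_eq_0) (auto dest!: keys_multD simp: keys_restr keys_nat_add)
  moreover have "restr ?P (?p * ?q') = 0"
    by (rule restr_eq_0) (auto dest!: keys_multD simp: keys_restr keys_nat_add)
  moreover have "restr ?P (?p * ?q) = ?p * ?q"
    by (rule restr_id) (auto dest!: keys_multD simp: keys_restr keys_nat_add)
  ultimately show ?thesis by (simp add: supp_restr_def)
qed

lemma supp_restr_in_varring: "supp_restr A p \<in> varring A"
  by (auto simp: supp_restr_def varring_def keys_restr)

lemma supp_restr_id: "p \<in> varring A \<Longrightarrow> supp_restr A p = p"
  unfolding supp_restr_def by (rule restr_id) (auto simp: varring_def)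

lemma supp_restr_add: "supp_restr A (p + q) = supp_restr A p + supp_restr A q"
  by (simp add: supp_restr_def restr_add)

lemma monomial_split:
  assumes "i \<in> keys (m :: nat \<Rightarrow>\<^sub>0 nat)"
  shows "m = single i 1 + (m - single i 1)"
  using assms by (intro poly_mapping_eqI)
    (auto simp: lookup_add lookup_minus lookup_single when_def in_keys_iff)

text \<open>For the inclusion from right to left, one variable is chosen in every monomial of
  \<open>p\<close>; the monomials are grouped by this choice and each group is divided by its
  variable.\<close>

lemma maxid_eq: "maxid n = {p \<in> varring {..<n}. 0 \<notin> keys p}" (is "_ = ?M")
proof
  show "maxid n \<subseteq> ?M"
  proof
    fix p :: "'a pol" assume "p \<in> maxid n"
    then obtain q where p: "p = (\<Sum>i<n. Var i * q i)" and q: "\<forall>i<n. q i \<in> varring {..<n}"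
      by (auto simp: maxid_def polyring_eq_varring)
    have "0 \<notin> keys (Var i * q i)" for i
    proof
      assume "0 \<in> keys (Var i * q i)"
      then obtain b where "0 = single i (1::nat) + b" by (auto dest!: keys_multD simp: Var_def)
      from arg_cong[OF this, of "\<lambda>m. lookup m i"] show False by (simp add: lookup_add)
    qed
    then have "0 \<notin> keys p" unfolding p by (auto dest: keys_sumD)
    moreover have "p \<in> varring {..<n}"
      unfolding p using q by (intro sum_in_varring mult_in_varring Var_in_varring) auto
    ultimately show "p \<in> ?M" by simp
  qed
  show "?M \<subseteq> maxid n"
  proof
    fix p :: "'a pol" assume p: "p \<in> ?M"
    define v where "v m = (SOME i. i \<in> keys m)" for m :: "nat \<Rightarrow>\<^sub>0 nat"
    have v: "v m \<in> keys m" if "m \<in> keys p" for m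
    proof -
      have "keys m \<noteq> {}" using that p by auto
      then show ?thesis unfolding v_def by (simp add: some_in_eq)
    qed
    have vn: "v m < n" if "m \<in> keys p" for m using v[OF that] p that by (auto simp: varring_def)
    define q where "q i = (\<Sum>m\<in>{m \<in> keys p. v m = i}. single (m - single i 1) (lookup p m))" for i
    have "Var i * q i = (\<Sum>m\<in>{m \<in> keys p. v m = i}. single m (lookup p m))" for i
      unfolding q_def sum_distrib_left
      by (rule sum.cong) (auto simp: Var_def mult_single v simp del: One_nat_def simp flip: monomial_split)
    then have "(\<Sum>i<n. Var i * q i) = (\<Sum>i<n. \<Sum>m\<in>{m \<in> keys p. v m = i}. single m (lookup p m))"
      by simp
    also have "\<dots> = (\<Sum>m\<in>keys p. single m (lookup p m))"
      by (rule sum.group) (auto simp: vn)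
    also have "\<dots> = p" using monomial_expansion[of p] by simp
    finally have "p = (\<Sum>i<n. Var i * q i)" by simp
    moreover have "q i \<in> varring {..<n}" for i
      unfolding q_def
    proof (intro sum_in_varring single_in_varring)
      fix m assume m: "m \<in> {m \<in> keys p. v m = i}"
      have "keys (m - single i 1) \<subseteq> keys m" by (auto simp: in_keys_iff lookup_minus)
      then show "keys (m - single i 1) \<subseteq> {..<n}" using m p by (fastforce simp: varring_def)
    qed
    ultimately show "p \<in> maxid n" by (auto simp: maxid_def polyring_eq_varring)
  qed
qed

section \<open>Gradings and retracts\<close>

lemma sum_components:
  assumes "finite G" "deg ` keys p \<subseteq> G"
  shows "p = (\<Sum>g\<in>G. restr (\<lambda>m. deg m = g) (p :: 'a \<Rightarrow>\<^sub>0 'b::comm_monoid_add))"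
proof (rule poly_mapping_eqI)
  fix m
  show "lookup p m = lookup (\<Sum>g\<in>G. restr (\<lambda>m. deg m = g) p) m"
    using assms by (cases "m \<in> keys p") (auto simp: lookup_sum lookup_restr in_keys_iff)
qed

lemma hom_restr: "hom deg g (restr (\<lambda>m. deg m = g) p)"
  by (simp add: hom_def keys_restr)

lemma hom_component: "hom deg g p \<Longrightarrow> restr (\<lambda>m. deg m = h) p = (if h = g then p else 0)"
  by (auto simp: hom_def intro!: restr_id restr_eq_0)

text \<open>The pieces provided by \<open>graded_subspace\<close> have pairwise distinct degrees, so
  restricting to one degree returns one of them or zero.\<close>

lemma graded_component:
  assumes "graded_subspace deg V" "0 \<in> V" "p \<in> V"
  shows "restr (\<lambda>m. deg m = g) p \<in> V"
proof -
  obtain G h where G: "finite G" "\<forall>g\<in>G. h g \<in> V \<and> hom deg g (h g)" and p: "p = (\<Sum>g\<in>G. h g)"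
    using assms unfolding graded_subspace_def by blast
  have "restr (\<lambda>m. deg m = g) p = (\<Sum>g'\<in>G. if g = g' then h g' else 0)"
    unfolding p restr_sum using G by (intro sum.cong) (auto simp: hom_component)
  then show ?thesis using G assms(2) by simp
qed

lemma subalgebra_zero: "subalgebra n S \<Longrightarrow> 0 \<in> S"
  and subalgebra_one: "subalgebra n S \<Longrightarrow> 1 \<in> S"
  by (metis const_0 subalgebra_def, metis const_1 subalgebra_def)

lemma subalgebra_const: "subalgebra n S \<Longrightarrow> const c \<in> S"
  and subalgebra_add: "subalgebra n S \<Longrightarrow> p \<in> S \<Longrightarrow> q \<in> S \<Longrightarrow> p + q \<in> S"
  and subalgebra_mult: "subalgebra n S \<Longrightarrow> p \<in> S \<Longrightarrow> q \<in> S \<Longrightarrow> p * q \<in> S"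
  by (simp_all add: subalgebra_def)

lemma subalgebra_sum: "subalgebra n S \<Longrightarrow> (\<And>x. x \<in> X \<Longrightarrow> f x \<in> S) \<Longrightarrow> sum f X \<in> S"
  by (induction X rule: infinite_finite_induct) (auto simp: subalgebra_zero subalgebra_add)

lemma subalgebra_prod: "subalgebra n S \<Longrightarrow> (\<And>x. x \<in> X \<Longrightarrow> f x \<in> S) \<Longrightarrow> prod f X \<in> S"
  by (induction X rule: infinite_finite_induct) (auto simp: subalgebra_one subalgebra_mult)

lemma subalgebra_power: "subalgebra n S \<Longrightarrow> p \<in> S \<Longrightarrow> p ^ e \<in> S"
  by (induction e) (auto simp: subalgebra_one subalgebra_mult)

lemma graded_subspaceI:
  assumes "\<And>p g. p \<in> V \<Longrightarrow> restr (\<lambda>m. deg m = g) p \<in> V"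
  shows "graded_subspace deg V"
  unfolding graded_subspace_def
proof
  fix p assume "p \<in> V"
  then show "\<exists>G h. finite G \<and> (\<forall>g\<in>G. h g \<in> V \<and> hom deg g (h g)) \<and> p = (\<Sum>g\<in>G. h g)"
    using assms sum_components[of "deg ` keys p" deg p] hom_restr[of deg _ p]
    by (intro exI[of _ "deg ` keys p"] exI[of _ "\<lambda>g. restr (\<lambda>m. deg m = g) p"]) auto
qed

text \<open>The retraction sets the variables outside \<open>A\<close> to zero. It only deletes
  monomials and so respects any degree function.\<close>

lemma graded_retract_varring:
  assumes "A \<subseteq> {..<n}"
  shows "graded_retract deg n (varring A)"
proof -
  have sub: "varring A \<subseteq> polyring n" using assms by (fastforce simp: polyring_eq_varring varring_def)
  have "subalgebra n (varring A)"
    using sub by (simp add: subalgebra_def const_in_varring add_in_varring mult_in_varring)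
  moreover have "graded_subspace deg (varring A)"
    by (rule graded_subspaceI) (auto simp: varring_def keys_restr)
  moreover have "hom deg g (supp_restr A p)" if "hom deg g p" for g p
    using that by (auto simp: hom_def supp_restr_def keys_restr)
  moreover have "supp_restr A ` polyring n = varring A"
    using sub supp_restr_id[of _ A] supp_restr_in_varring[of A] by force
  ultimately show ?thesis unfolding graded_retract_def
    by (intro conjI exI[of _ "supp_restr A"])
      (auto simp: supp_restr_add supp_restr_mult supp_restr_id const_in_varring supp_restr_in_varring)
qed

text \<open>A component for the coarse degree is a finite sum of components for the fine degree, and
  the retraction is additive. This carries multigraded retracts over to the standard
  grading.\<close>

lemma graded_retract_coarsen:
  assumes R: "graded_retract deg n S" and T: "\<And>m. deg' m = T (deg m)"
  shows "graded_retract deg' n S"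
proof -
  obtain \<pi> where sub: "subalgebra n S" and gr: "graded_subspace deg S"
    and \<pi>: "\<forall>p \<in> polyring n. \<pi> p \<in> S" "\<pi> ` polyring n = S"
      "\<forall>p \<in> polyring n. \<forall>q \<in> polyring n. \<pi> (p + q) = \<pi> p + \<pi> q \<and> \<pi> (p * q) = \<pi> p * \<pi> q"
      "\<forall>c. \<pi> (const c) = const c"
      "\<forall>p \<in> polyring n. \<forall>g. hom deg g p \<longrightarrow> hom deg g (\<pi> p)"
      "\<forall>p \<in> S. \<pi> p = p"
    using R unfolding graded_retract_def by blast
  have "graded_subspace deg' S"
  proof (rule graded_subspaceI)
    fix p t assume p: "p \<in> S"
    have "restr (\<lambda>m. deg' m = t) p
        = (\<Sum>g\<in>deg ` keys p. restr (\<lambda>m. deg' m = t) (restr (\<lambda>m. deg m = g) p))"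
      using arg_cong[OF sum_components[of "deg ` keys p" deg p], of "restr (\<lambda>m. deg' m = t)"]
      by (simp add: restr_sum)
    also have "\<dots> = (\<Sum>g\<in>deg ` keys p. if T g = t then restr (\<lambda>m. deg m = g) p else 0)"
      by (intro sum.cong) (auto simp: T keys_restr intro!: restr_id restr_eq_0)
    also have "\<dots> \<in> S"
      using graded_component[OF gr subalgebra_zero[OF sub] p] subalgebra_zero[OF sub]
      by (intro subalgebra_sum[OF sub]) auto
    finally show "restr (\<lambda>m. deg' m = t) p \<in> S" .
  qed
  moreover have "hom deg' t (\<pi> p)" if p: "p \<in> polyring n" and hp: "hom deg' t p" for p t
  proof -
    have comp: "restr (\<lambda>m. deg m = g) p \<in> polyring n" for g
      using p by (auto simp: polyring_def keys_restr)
    have \<pi>_sum: "\<pi> (\<Sum>g\<in>G. restr (\<lambda>m. deg m = g) p) = (\<Sum>g\<in>G. \<pi> (restr (\<lambda>m. deg m = g) p))"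
      if "finite G" for G using that
    proof (induction G rule: finite_induct)
      case empty
      then show ?case using \<pi>(4)[rule_format, of 0] by simp
    next
      case (insert g G)
      have "(\<Sum>g\<in>G. restr (\<lambda>m. deg m = g) p) \<in> polyring n"
        using comp unfolding polyring_eq_varring by (intro sum_in_varring)
      then show ?case using insert \<pi>(3) comp[of g] by simp
    qed
    have \<pi>p: "\<pi> p = (\<Sum>g\<in>deg ` keys p. \<pi> (restr (\<lambda>m. deg m = g) p))"
      using \<pi>_sum[of "deg ` keys p"] sum_components[of "deg ` keys p" deg p] by simp
    have \<pi>c: "hom deg g (\<pi> (restr (\<lambda>m. deg m = g) p))" for g
      by (rule \<pi>(5)[rule_format, OF comp hom_restr])
    show ?thesis
      unfolding hom_def
    proof
      fix m assume "m \<in> keys (\<pi> p)"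
      then obtain m' where m': "m' \<in> keys p" "m \<in> keys (\<pi> (restr (\<lambda>m. deg m = deg m') p))"
        unfolding \<pi>p using keys_sumD by fast
      then have "deg m = deg m'" using \<pi>c[of "deg m'"] unfolding hom_def by blast
      then show "deg' m = t" using T hp m'(1) unfolding hom_def by metis
    qed
  qed
  ultimately show ?thesis unfolding graded_retract_def
    by (intro conjI exI[of _ \<pi>]) (use sub \<pi> in auto)
qed

section \<open>Total degree and the filtration by degree\<close>

lemma tdeg_add: "tdeg (a + b) = tdeg a + tdeg b"
  unfolding tdeg_def using setsum_keys_plus_distrib[of "\<lambda>_ e. e" a b]
  by (simp only: of_nat_add)

lemma tdeg_0 [simp]: "tdeg 0 = 0"
  and tdeg_single [simp]: "tdeg (single i e) = int e"
  by (simp_all add: tdeg_def)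

lemma tdeg_nonneg: "tdeg m \<ge> 0"
  unfolding tdeg_def by (rule of_nat_0_le_iff)

lemma tdeg_eq_0_iff: "tdeg m = 0 \<longleftrightarrow> m = 0"
  by (auto simp: tdeg_def in_keys_iff simp del: of_nat_sum intro!: poly_mapping_eqI)

lemma monomial_nonzeroE:
  assumes "m \<noteq> 0"
  obtains i m' where "i \<in> keys m" "m = single i 1 + m'" "tdeg m = 1 + tdeg m'" "keys m' \<subseteq> keys m"
proof -
  obtain i where i: "i \<in> keys m" using assms by (metis keys_eq_empty ex_in_conv)
  show ?thesis
    using that[of i "m - single i 1"] monomial_split[OF i] i
    by (metis tdeg_add tdeg_single of_nat_1 keys_nat_add Un_upper2)
qed

lemma tdeg_eq_1:
  assumes "tdeg m = 1"
  obtains i where "i \<in> keys m" "m = single i 1"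
  using assms monomial_nonzeroE[of m] tdeg_eq_0_iff
  by (metis add.right_neutral add_cancel_right_right tdeg_0 zero_neq_one)

definition deg_le :: "nat \<Rightarrow> 'k::field pol \<Rightarrow> bool" where
  "deg_le k p \<longleftrightarrow> (\<forall>m\<in>keys p. tdeg m \<le> int k)"

lemma deg_le_mult: "deg_le a p \<Longrightarrow> deg_le b q \<Longrightarrow> deg_le (a + b) (p * q)"
  by (fastforce simp: deg_le_def tdeg_add dest!: keys_multD)

lemma deg_le_power: "deg_le a p \<Longrightarrow> deg_le (e * a) (p ^ e)"
proof (induction e)
  case 0
  then show ?case by (simp add: deg_le_def)
next
  case (Suc e)
  then show ?case using deg_le_mult[of a p "e * a" "p ^ e"] by simp
qed

lemma deg_le_prod: "(\<And>x. x \<in> X \<Longrightarrow> deg_le (a x) (f x)) \<Longrightarrow> deg_le (sum a X) (prod f X)"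
proof (induction X rule: infinite_finite_induct)
  case (insert x X)
  then show ?case using deg_le_mult[of "a x" "f x"] by simp
qed (simp_all add: deg_le_def)

lemma deg_le_mono: "deg_le a p \<Longrightarrow> a \<le> b \<Longrightarrow> deg_le b p"
  by (fastforce simp: deg_le_def)

lemma deg_le_ex: "\<exists>a. deg_le a p"
proof -
  have "deg_le (nat (\<Sum>m\<in>keys p. tdeg m)) p"
    unfolding deg_le_def using member_le_sum[of _ "keys p" tdeg] tdeg_nonneg
    by (fastforce simp: sum_nonneg)
  then show ?thesis ..
qed

section \<open>Retracts in the standard grading are generated by linear forms\<close>

definition linear_forms :: "'k::field pol set \<Rightarrow> 'k pol set" where
  "linear_forms S = {p \<in> S. hom tdeg 1 p}"

text \<open>A maximal independent set of linear forms is finite because the \<open>n\<close>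
  variables span all linear forms.\<close>

lemma linear_forms_basis:
  fixes S :: "'k::field pol set"
  assumes "S \<subseteq> polyring n"
  obtains B where "finite B" "B \<subseteq> linear_forms S" "\<not> pol.dependent B" "linear_forms S \<subseteq> pol.span B"
proof -
  obtain B where B: "B \<subseteq> linear_forms S" "\<not> pol.dependent B" "linear_forms S \<subseteq> pol.span B"
    using pol.maximal_independent_subset by blast
  let ?X = "(\<lambda>i. single i 1) ` {..<n} :: (nat \<Rightarrow>\<^sub>0 nat) set"
  have "linear_forms S \<subseteq> pol.span ((\<lambda>m. single m 1) ` ?X)"
  proof
    fix p assume p: "p \<in> linear_forms S"
    have "keys p \<subseteq> ?X"
    proof
      fix m assume m: "m \<in> keys p"
      then have "tdeg m = 1" "keys m \<subseteq> {..<n}"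
        using p assms by (auto simp: linear_forms_def hom_def polyring_def)
      then show "m \<in> ?X" by (metis tdeg_eq_1 subsetD imageI)
    qed
    then show "p \<in> pol.span ((\<lambda>m. single m 1) ` ?X)" by (rule span_monomials)
  qed
  then have "finite B"
    using B pol.independent_span_bound[of "(\<lambda>m. single m 1) ` ?X" B] by auto
  then show ?thesis using that B by blast
qed

lemma span_mult_span:
  assumes "p \<in> pol.span X" "q \<in> pol.span Y" "\<And>x y. x \<in> X \<Longrightarrow> y \<in> Y \<Longrightarrow> x * y \<in> pol.span Z"
  shows "p * q \<in> pol.span Z"
  using assms(1)
proof (induction rule: pol.span_induct_alt)
  case base
  then show ?case by (simp add: pol.span_zero)
next
  case (step c x p)
  have "x * q \<in> pol.span Z" using assms(2)
  proof (induction rule: pol.span_induct_alt)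
    case base
    then show ?case by (simp add: pol.span_zero)
  next
    case (step d y q)
    have "const d * (x * y) + x * q \<in> pol.span Z"
      using step assms(3) \<open>x \<in> X\<close> by (intro pol.span_add pol.span_scale)
    then show ?case by (simp add: distrib_left mult.left_commute)
  qed
  then have "const c * (x * q) + p * q \<in> pol.span Z"
    using step by (intro pol.span_add pol.span_scale)
  then show ?case by (simp add: distrib_right mult.assoc)
qed

text \<open>The retraction maps each variable to a linear form of \<open>S\<close>, hence a monomial
  of degree at most \<open>k\<close> to a product of at most \<open>k\<close> such forms, and it
  fixes \<open>p\<close>. Bounding each exponent by \<open>k\<close>, rather than their sum,
  enlarges the spanning set but makes it a box that is easy to count.\<close>

lemma retract_deg_le_span:
  fixes S :: "'k::field pol set"
  assumes R: "graded_retract tdeg n S" and B: "finite B" "linear_forms S \<subseteq> pol.span B"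
    and p: "p \<in> S" "deg_le k p"
  shows "p \<in> pol.span ((\<lambda>e. \<Prod>b\<in>B. b ^ e b) ` (B \<rightarrow>\<^sub>E {..k}))"
proof -
  define T where "T k = (\<lambda>e. \<Prod>b\<in>B. b ^ e b) ` (B \<rightarrow>\<^sub>E {..k})" for k :: nat
  obtain \<pi> where sub: "subalgebra n S" and gr: "graded_subspace tdeg S"
    and \<pi>: "\<forall>p \<in> polyring n. \<pi> p \<in> S" "\<pi> ` polyring n = S"
      "\<forall>p \<in> polyring n. \<forall>q \<in> polyring n. \<pi> (p + q) = \<pi> p + \<pi> q \<and> \<pi> (p * q) = \<pi> p * \<pi> q"
      "\<forall>c. \<pi> (const c) = const c"
      "\<forall>p \<in> polyring n. \<forall>g. hom tdeg g p \<longrightarrow> hom tdeg g (\<pi> p)"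
      "\<forall>p \<in> S. \<pi> p = p"
    using R unfolding graded_retract_def by blast
  have T_mono: "pol.span (T k) \<subseteq> pol.span (T k')" if "k \<le> k'" for k k'
    unfolding T_def by (intro pol.span_mono image_mono PiE_mono) (use that in auto)
  have T_step: "x * b \<in> pol.span (T (Suc k))" if x: "x \<in> T k" and b: "b \<in> B" for x b k
  proof -
    obtain e where e: "x = (\<Prod>b\<in>B. b ^ e b)" "e \<in> B \<rightarrow>\<^sub>E {..k}"
      using x unfolding T_def by blast
    let ?e = "e(b := Suc (e b))"
    have "(\<Prod>c\<in>B. c ^ ?e c) = b ^ Suc (e b) * (\<Prod>c\<in>B - {b}. c ^ e c)"
      using B(1) b by (subst prod.remove[of _ b]) (auto intro!: prod.cong)
    also have "\<dots> = x * b" using B(1) b e by (simp add: prod.remove[of B b] mult_ac)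
    finally have "x * b = (\<Prod>c\<in>B. c ^ ?e c)" by simp
    moreover have "?e \<in> B \<rightarrow>\<^sub>E {..Suc k}" using e(2) b by (auto simp: PiE_iff extensional_def)
    ultimately show ?thesis unfolding T_def by (intro pol.span_base) blast
  qed
  have mono: "\<pi> (single m 1) \<in> pol.span (T j)"
    if "keys m \<subseteq> {..<n}" "tdeg m \<le> int j" for m j
    using that
  proof (induction j arbitrary: m)
    case 0
    then have "m = 0" using tdeg_nonneg[of m] tdeg_eq_0_iff by force
    then have "\<pi> (single m 1) = 1" using \<pi>(4)[rule_format, of 1] by simp
    moreover have "(1 :: 'k pol) \<in> T 0"
      unfolding T_def by (rule image_eqI[of _ _ "\<lambda>b\<in>B. 0"]) auto
    ultimately show ?case by (simp add: pol.span_base)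
  next
    case (Suc j)
    show ?case
    proof (cases "m = 0")
      case True
      then show ?thesis using Suc.IH[of 0] T_mono[of j "Suc j"] by auto
    next
      case False
      obtain i m' where m: "i \<in> keys m" "m = single i 1 + m'" "tdeg m = 1 + tdeg m'" "keys m' \<subseteq> keys m"
        using monomial_nonzeroE[OF False] .
      have V: "Var i \<in> polyring n" using m Suc.prems by (auto simp: polyring_def Var_def)
      have m': "single m' (1::'k) \<in> polyring n" using m Suc.prems by (auto simp: polyring_def)
      have "hom tdeg 1 (Var i :: 'k pol)" by (simp add: hom_def Var_def)
      \<comment> \<open>The retraction preserves degree, so the image of a variable is a linear form
        lying in \<open>S\<close>.\<close>
      then have "\<pi> (Var i) \<in> pol.span B" using V \<pi>(1,5) B(2) by (auto simp: linear_forms_def)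
      moreover have "\<pi> (single m' 1) \<in> pol.span (T j)" using Suc m by auto
      ultimately have "\<pi> (single m' 1) * \<pi> (Var i) \<in> pol.span (T (Suc j))"
        using span_mult_span T_step by blast
      moreover have "single m (1::'k) = single m' 1 * Var i"
        using m(2) by (simp add: Var_def mult_single add.commute)
      ultimately show ?thesis using \<pi>(3)[rule_format, OF m' V] by simp
    qed
  qed
  have pn: "p \<in> polyring n" using sub p by (auto simp: subalgebra_def)
  have "X \<subseteq> keys p \<Longrightarrow> \<pi> (\<Sum>m\<in>X. single m (lookup p m)) \<in> pol.span (T k)" for X
  proof (induction X rule: infinite_finite_induct)
    case (insert m X)
    have kn: "keys m' \<subseteq> {..<n}" if "m' \<in> keys p" for m' using pn that by (simp add: polyring_def)
    then have m: "single m (lookup p m) \<in> polyring n" "(\<Sum>m\<in>X. single m (lookup p m)) \<in> polyring n"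
      "single m (1::'k) \<in> polyring n"
      using insert unfolding polyring_eq_varring
      by (auto intro!: sum_in_varring single_in_varring simp del: lessThan_iff)
    have "const (lookup p m) \<in> polyring n" unfolding polyring_eq_varring by (rule const_in_varring)
    then have "\<pi> (single m (lookup p m)) = const (lookup p m) * \<pi> (single m 1)"
      using \<pi>(3)[rule_format, OF _ m(3), of "const (lookup p m)"] \<pi>(4) by (simp add: const_mult_single)
    moreover have "\<pi> (single m 1) \<in> pol.span (T k)"
      using mono[of m k] insert p pn by (auto simp: deg_le_def polyring_def)
    ultimately show ?case using insert m \<pi>(3) by (simp add: pol.span_add pol.span_scale)
  qed (use \<pi>(4)[rule_format, of 0] in \<open>auto simp: pol.span_zero\<close>)
  from this[of "keys p"] have "\<pi> p \<in> pol.span (T k)" unfolding monomial_expansion[symmetric] by simp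
  then show ?thesis using \<pi>(6) p T_def by simp
qed

section \<open>Krull dimension of retracts\<close>

lemma prime_inD:
  assumes "prime_in S P"
  shows "P \<subseteq> S" "0 \<in> P" "\<And>a b. a \<in> P \<Longrightarrow> b \<in> P \<Longrightarrow> a + b \<in> P"
    "\<And>s a. s \<in> S \<Longrightarrow> a \<in> P \<Longrightarrow> s * a \<in> P" "P \<noteq> S"
    "\<And>a b. a \<in> S \<Longrightarrow> b \<in> S \<Longrightarrow> a * b \<in> P \<Longrightarrow> a \<in> P \<or> b \<in> P"
  using assms unfolding prime_in_def ideal_in_def by blast+

lemma prime_in_const:
  assumes "subalgebra n S" "prime_in S P" "const c \<in> P"
  shows "c = 0"
proof (rule ccontr)
  assume "c \<noteq> 0"
  then have "const (inverse c) * const c = 1" by (simp flip: const_mult)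
  then have "1 \<in> P" using prime_inD(4)[OF assms(2) subalgebra_const[OF assms(1)] assms(3)] by metis
  then have "s \<in> P" if "s \<in> S" for s using prime_inD(4)[OF assms(2) that] by force
  then show False using prime_inD(1,5)[OF assms(2)] by blast
qed

lemma prime_in_sum:
  assumes "prime_in S P" "\<And>x. x \<in> X \<Longrightarrow> f x \<in> P"
  shows "sum f X \<in> P"
  using assms(2) by (induction X rule: infinite_finite_induct) (auto simp: prime_inD[OF assms(1)])

lemma prime_in_power:
  assumes "subalgebra n S" "prime_in S P" "x \<in> S" "x ^ e \<in> P"
  shows "x \<in> P"
  using assms(4)
proof (induction e)
  case 0
  then have "const 1 \<in> P" by simp
  then show ?case using prime_in_const[OF assms(1,2)] one_neq_zero by blast
next
  case (Suc e)
  then show ?case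
    using prime_inD(6)[OF assms(2,3) subalgebra_power[OF assms(1,3)], of e] by auto
qed

lemma prime_in_diff:
  assumes "subalgebra n S" "prime_in S P" "a + b \<in> P" "b \<in> P"
  shows "a \<in> P"
proof -
  have "const (- 1) * b = - b" by (simp add: const_def single_uminus)
  then have "- b \<in> P" using prime_inD(4)[OF assms(2) subalgebra_const[OF assms(1)] assms(4)] by metis
  then have "a + b + - b \<in> P" using prime_inD(3)[OF assms(2,3)] by blast
  then show ?thesis by simp
qed

text \<open>Separating elements of a chain of primes are algebraically independent: dividing a relation
  by the least power of \<open>x j\<close> and reducing modulo \<open>P (Suc j)\<close> leaves a relation between the
  later elements.\<close>

lemma prime_chain_independent:
  fixes u :: "(nat \<Rightarrow> nat) \<Rightarrow> 'k::field"
  assumes S: "subalgebra n S"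
    and P: "\<And>i. i \<le> d \<Longrightarrow> prime_in S (P i)"
    and sub: "\<And>i. i < d \<Longrightarrow> P i \<subseteq> P (Suc i)"
    and x: "\<And>i. i < d \<Longrightarrow> x i \<in> P (Suc i)" "\<And>i. i < d \<Longrightarrow> x i \<notin> P i"
    and "j \<le> d" "finite E" "inj_on (\<lambda>e. restrict e {j..<d}) E"
    and "(\<Sum>e\<in>E. const (u e) * (\<Prod>i\<in>{j..<d}. x i ^ e i)) \<in> P j"
  shows "\<forall>e\<in>E. u e = 0"
  using assms(6-9)
proof (induction arbitrary: E rule: inc_induct)
  case base
  show ?case
  proof
    fix e assume "e \<in> E"
    \<comment> \<open>All restrictions to the empty interval coincide, so injectivity leaves a
      single exponent, and the relation becomes a constant in \<open>P d\<close>.\<close>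
    then have "E = {e}" using base.prems(2) by (auto simp: inj_on_def)
    then have "const (u e) \<in> P d" using base.prems(3) by simp
    then show "u e = 0" using prime_in_const[OF S P] by blast
  qed
next
  case (step j)
  have xS: "x i \<in> S" if "i < d" for i using x(1)[OF that] prime_inD(1)[OF P[of "Suc i"]] that by auto
  define M where "M e = (\<Prod>i\<in>{Suc j..<d}. x i ^ e i)" for e
  have MS: "M e \<in> S" for e
    unfolding M_def by (intro subalgebra_prod[OF S] subalgebra_power[OF S] xS) auto
  have prod: "(\<Prod>i\<in>{j..<d}. x i ^ e i) = x j ^ e j * M e" for e
    using step.hyps by (simp add: M_def prod.atLeast_Suc_lessThan)
  define E' where "E' = {e \<in> E. u e \<noteq> 0}"
  have fin: "finite E'" using step.prems by (simp add: E'_def)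
  show ?case
  proof (rule ccontr)
    assume "\<not> ?thesis"
    then have ne: "E' \<noteq> {}" by (auto simp: E'_def)
    define N where "N = Min ((\<lambda>e. e j) ` E')"
    have N: "N \<le> e j" if "e \<in> E'" for e using fin that by (simp add: N_def)
    define E0 where "E0 = {e \<in> E'. e j = N}"
    have "N \<in> (\<lambda>e. e j) ` E'" unfolding N_def using fin ne by (intro Min_in) auto
    then have ne0: "E0 \<noteq> {}" by (auto simp: E0_def)
    define Q where "Q e = const (u e) * (x j ^ (e j - N) * M e)" for e
    have QS: "Q e \<in> S" for e unfolding Q_def
      by (intro subalgebra_mult[OF S] subalgebra_const[OF S] subalgebra_power[OF S] xS MS step.hyps)
    have "(\<Sum>e\<in>E. const (u e) * (\<Prod>i\<in>{j..<d}. x i ^ e i))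
        = (\<Sum>e\<in>E'. const (u e) * (\<Prod>i\<in>{j..<d}. x i ^ e i))"
      using step.prems(1) by (intro sum.mono_neutral_right) (auto simp: E'_def)
    also have "\<dots> = (\<Sum>e\<in>E'. x j ^ N * Q e)"
    proof (rule sum.cong)
      fix e assume "e \<in> E'"
      then have "x j ^ e j = x j ^ N * x j ^ (e j - N)" using N[of e] by (simp flip: power_add)
      then show "const (u e) * (\<Prod>i\<in>{j..<d}. x i ^ e i) = x j ^ N * Q e"
        by (simp add: prod Q_def mult_ac)
    qed simp
    finally have "x j ^ N * (\<Sum>e\<in>E'. Q e) \<in> P j"
      using step.prems(3) by (simp add: sum_distrib_left)
    moreover have "x j ^ N \<notin> P j"
      using prime_in_power[OF S P xS] x(2) step.hyps by (metis less_imp_le)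
    moreover have "x j ^ N \<in> S" "(\<Sum>e\<in>E'. Q e) \<in> S"
      by (intro subalgebra_power[OF S] subalgebra_sum[OF S] xS QS step.hyps)+
    ultimately have "(\<Sum>e\<in>E'. Q e) \<in> P j"
      using prime_inD(6)[OF P[of j]] step.hyps by (meson less_imp_le)
    then have "(\<Sum>e\<in>E'. Q e) \<in> P (Suc j)" using sub step.hyps by auto
    moreover have "(\<Sum>e\<in>E'. Q e) = (\<Sum>e\<in>E0. Q e) + (\<Sum>e\<in>E' - E0. Q e)"
      using fin by (subst add.commute, intro sum.subset_diff) (auto simp: E0_def)
    moreover have "(\<Sum>e\<in>E' - E0. Q e) \<in> P (Suc j)"
    proof (rule prime_in_sum)
      show pr: "prime_in S (P (Suc j))" using P step.hyps by simp
      fix e assume "e \<in> E' - E0"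
      then have "e j - N \<noteq> 0" using N[of e] by (auto simp: E0_def)
      then obtain l where "e j - N = Suc l" by (cases "e j - N") auto
      then have "Q e = (const (u e) * x j ^ l * M e) * x j" by (simp add: Q_def mult_ac)
      moreover have "const (u e) * x j ^ l * M e \<in> S"
        by (intro subalgebra_mult[OF S] subalgebra_const[OF S] subalgebra_power[OF S] xS MS step.hyps)
      ultimately show "Q e \<in> P (Suc j)" using prime_inD(4)[OF pr] x(1) step.hyps by simp
    qed
    ultimately have "(\<Sum>e\<in>E0. Q e) \<in> P (Suc j)"
      using prime_in_diff[OF S P[of "Suc j"]] step.hyps by auto
    moreover have "(\<Sum>e\<in>E0. Q e) = (\<Sum>e\<in>E0. const (u e) * (\<Prod>i\<in>{Suc j..<d}. x i ^ e i))"
      by (intro sum.cong) (auto simp: Q_def E0_def M_def)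
    ultimately have "(\<Sum>e\<in>E0. const (u e) * (\<Prod>i\<in>{Suc j..<d}. x i ^ e i)) \<in> P (Suc j)" by simp
    \<comment> \<open>On \<open>E0\<close> the exponent of \<open>x j\<close> is always
      \<open>N\<close>, so exponents that agree from \<open>Suc j\<close> on agree from
      \<open>j\<close> on.\<close>
    moreover have "inj_on (\<lambda>e. restrict e {Suc j..<d}) E0"
    proof (rule inj_onI)
      fix e e' assume ee: "e \<in> E0" "e' \<in> E0" and eq: "restrict e {Suc j..<d} = restrict e' {Suc j..<d}"
      have "e i = e' i" if "i \<in> {j..<d}" for i
        using that ee fun_cong[OF eq, of i] by (cases "i = j") (auto simp: E0_def)
      then have "restrict e {j..<d} = restrict e' {j..<d}" by (auto simp: restrict_def)
      then show "e = e'" by (rule inj_onD[OF step.prems(2)]) (use ee in \<open>auto simp: E0_def E'_def\<close>)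
    qed
    moreover have "finite E0" using fin by (simp add: E0_def)
    ultimately have "\<forall>e\<in>E0. u e = 0" by (intro step.IH)
    then show False using ne0 by (auto simp: E0_def E'_def)
  qed
qed

text \<open>If the chain were longer than \<open>r = card B\<close>, elements separating its first
  \<open>r + 1\<close> steps would be algebraically independent. Their products with exponents up to
  \<open>N\<close> number \<open>(N + 1) ^ (r + 1)\<close>, but lie in a space spanned by
  \<open>(N * D + 1) ^ r\<close> products of linear forms.\<close>

lemma prime_chain_length:
  fixes S :: "'k::field pol set"
  assumes R: "graded_retract tdeg n S" and B: "finite B" "linear_forms S \<subseteq> pol.span B"
    and P: "\<forall>i\<le>d. prime_in S (P i)" "\<forall>i<d. P i \<subset> P (Suc i)"
  shows "d \<le> card B"
proof (rule ccontr)
  define r where "r = card B"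
  assume "\<not> d \<le> card B"
  then have rd: "Suc r \<le> d" by (simp add: r_def)
  have S: "subalgebra n S" using R by (simp add: graded_retract_def)
  have "\<forall>i. \<exists>x. i < d \<longrightarrow> x \<in> P (Suc i) - P i" using P(2) by blast
  then obtain x where x: "\<And>i. i < d \<Longrightarrow> x i \<in> P (Suc i) - P i" by metis
  have xS: "x i \<in> S" if "i < d" for i
    using x[OF that] P(1) that prime_inD(1)[of S "P (Suc i)"] by (auto simp: Suc_le_eq)
  have "\<forall>i. \<exists>a. deg_le a (x i)" using deg_le_ex by blast
  then obtain a where a: "\<And>i. deg_le (a i) (x i)" by metis
  define D where "D = (\<Sum>i<Suc r. a i)"
  \<comment> \<open>These choices give \<open>N * D + 1 \<le> (N + 1) * c\<close>, hence
    \<open>(N * D + 1) ^ r \<le> (N + 1) ^ r * N\<close>, which is below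
    \<open>(N + 1) ^ (r + 1)\<close>.\<close>
  define c where "c = D + 1"
  define N where "N = c ^ r"
  define J where "J = {0..<Suc r} \<rightarrow>\<^sub>E {..N}"
  define T where "T = (\<lambda>e. \<Prod>b\<in>B. b ^ e b) ` (B \<rightarrow>\<^sub>E {..N * D})"
  define v where "v e = (\<Prod>i\<in>{0..<Suc r}. x i ^ e i)" for e
  have finJ: "finite J" unfolding J_def by (intro finite_PiE) auto
  have finT: "finite T" unfolding T_def using B(1) by (intro finite_imageI finite_PiE) auto
  have "v ` J \<subseteq> pol.span T"
  proof
    fix p assume "p \<in> v ` J"
    then obtain e where e: "e \<in> J" "p = v e" by blast
    have "deg_le (\<Sum>i\<in>{0..<Suc r}. e i * a i) p"
      unfolding e(2) v_def by (intro deg_le_prod deg_le_power a)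
    moreover have "(\<Sum>i\<in>{0..<Suc r}. e i * a i) \<le> (\<Sum>i\<in>{0..<Suc r}. N * a i)"
      using e(1) by (intro sum_mono mult_right_mono) (auto simp: J_def PiE_iff)
    then have "(\<Sum>i\<in>{0..<Suc r}. e i * a i) \<le> N * D"
      by (simp only: D_def sum_distrib_left atLeast0LessThan)
    ultimately have "deg_le (N * D) p" by (rule deg_le_mono)
    moreover have "p \<in> S" unfolding e(2) v_def
      using rd by (intro subalgebra_prod[OF S] subalgebra_power[OF S] xS) auto
    ultimately show "p \<in> pol.span T" unfolding T_def using retract_deg_le_span[OF R B] by blast
  qed
  moreover have "\<forall>e\<in>J. u e = 0" if "(\<Sum>e\<in>J. const (u e) * v e) = 0" for u
  proof (rule prime_chain_independent[OF S, of "Suc r" P x 0])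
    show "inj_on (\<lambda>e. restrict e {0..<Suc r}) J"
      by (auto simp: inj_on_def J_def PiE_iff extensional_restrict)
    show "(\<Sum>e\<in>J. const (u e) * (\<Prod>i = 0..<Suc r. x i ^ e i)) \<in> P 0"
      using that prime_inD(2)[of S "P 0"] P(1) by (simp add: v_def)
    show "P i \<subseteq> P (Suc i)" if "i < Suc r" for i
      using P(2) rd that by (meson less_le_trans psubset_imp_subset)
  qed (use P(1) x rd finJ in auto)
  ultimately have "card J \<le> card T" using card_le_if_independent_family[OF finJ finT] by blast
  also have "\<dots> \<le> card (B \<rightarrow>\<^sub>E {..N * D})"
    unfolding T_def using B(1) by (intro card_image_le finite_PiE) auto
  also have "\<dots> = (N * D + 1) ^ r" using B(1) by (simp add: card_PiE r_def)
  also have "\<dots> \<le> ((N + 1) * c) ^ r" by (intro power_mono) (auto simp: c_def)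
  also have "\<dots> = (N + 1) ^ r * N" by (simp only: power_mult_distrib) (simp add: N_def)
  also have "\<dots> < (N + 1) ^ Suc r" by simp
  also have "\<dots> = card J" by (simp add: J_def card_PiE)
  finally show False by simp
qed

lemma krull_dim_le:
  assumes "graded_retract tdeg n S" "finite B" "linear_forms S \<subseteq> pol.span B"
  shows "krull_dim S \<le> card B"
proof -
  let ?X = "{d. \<exists>P. (\<forall>i\<le>d. prime_in S (P i)) \<and> (\<forall>i<d. P i \<subset> P (Suc i))}"
  have "\<And>d. d \<in> ?X \<Longrightarrow> d \<le> card B" using prime_chain_length[OF assms] by blast
  then show ?thesis unfolding krull_dim_def
    \<comment> \<open>Over the naturals the supremum of the empty set is 0, which settles the
      degenerate case.\<close>
    by (cases "?X = {}") (auto intro!: cSup_least simp del: Collect_empty_eq)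
qed

text \<open>Setting the variables of \<open>A\<close> to zero one after the other gives a chain of
  kernels. They are prime because each substitution is a ring homomorphism into a domain, and the
  \<open>i\<close>-th variable separates consecutive kernels.\<close>

lemma krull_dim_varring_ge:
  fixes A :: "nat set"
  assumes "A \<subseteq> {..<n}"
  shows "card A \<le> krull_dim (varring A :: 'k::field pol set)"
proof -
  let ?S = "varring A :: 'k pol set"
  let ?X = "{d. \<exists>P. (\<forall>i\<le>d. prime_in ?S (P i)) \<and> (\<forall>i<d. P i \<subset> P (Suc i))}"
  have R: "graded_retract tdeg n ?S" using graded_retract_varring[OF assms] .
  then have "?S \<subseteq> polyring n" by (simp add: graded_retract_def subalgebra_def)
  then obtain B where "finite B" "linear_forms ?S \<subseteq> pol.span B" using linear_forms_basis by metis
  \<comment> \<open>A member of the set lies below its supremum only once the chain lengths are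
    known to be bounded.\<close>
  then have bdd: "bdd_above ?X" using prime_chain_length[OF R] by (intro bdd_aboveI[of _ "card B"]) blast
  have "finite A" using assms finite_subset by blast
  then obtain b where b: "bij_betw b {..<card A} A"
    using ex_bij_betw_nat_finite[of A] by (auto simp: atLeast0LessThan)
  define P where "P i = {p \<in> ?S. supp_restr (A - b ` {..<i}) p = 0}" for i
  have z: "supp_restr C (0 :: 'k pol) = 0" for C by (simp add: supp_restr_def)
  have "prime_in ?S (P i)" for i
  proof -
    have "supp_restr C (1 :: 'k pol) = 1" for C by (rule supp_restr_id[OF one_in_varring])
    then have "(1 :: 'k pol) \<notin> P i" by (simp add: P_def)
    then have "P i \<noteq> ?S" using one_in_varring by blast
    then show ?thesis unfolding prime_in_def ideal_in_def
      by (auto simp: P_def z zero_in_varring add_in_varring mult_in_varring supp_restr_add supp_restr_mult)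
  qed
  moreover have "P i \<subset> P (Suc i)" if i: "i < card A" for i
  proof
    have "supp_restr (A - b ` {..<Suc i}) p = 0" if "supp_restr (A - b ` {..<i}) p = 0" for p :: "'k pol"
    proof -
      have "supp_restr (A - b ` {..<Suc i}) p = supp_restr (A - b ` {..<Suc i}) (supp_restr (A - b ` {..<i}) p)"
        unfolding supp_restr_def by (rule poly_mapping_eqI) (auto simp: lookup_restr)
      then show ?thesis using that z by simp
    qed
    then show "P i \<subseteq> P (Suc i)" by (auto simp: P_def)
    have bi: "b i \<in> A" using b i by (auto simp: bij_betw_def)
    have "b i \<notin> b ` {..<i}" using b i by (fastforce simp: bij_betw_def inj_on_def)
    then have "supp_restr (A - b ` {..<i}) (Var (b i) :: 'k pol) = Var (b i)"
      using bi by (intro supp_restr_id Var_in_varring) auto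
    then have "Var (b i) \<notin> P i" by (auto simp: P_def Var_def simp flip: keys_eq_empty)
    moreover have "supp_restr (A - b ` {..<Suc i}) (Var (b i) :: 'k pol) = 0"
      unfolding supp_restr_def by (rule restr_eq_0) (auto simp: Var_def)
    then have "Var (b i) \<in> P (Suc i)" using bi by (auto simp: P_def Var_in_varring)
    ultimately show "P i \<noteq> P (Suc i)" by blast
  qed
  ultimately have "card A \<in> ?X" by blast
  then show ?thesis unfolding krull_dim_def using cSup_upper[OF _ bdd] by blast
qed

section \<open>Hilbert decompositions\<close>

lemma lookup_mdeg: "lookup (mdeg m) i = int (lookup m i)"
  unfolding mdeg_def by transfer (simp add: when_def)

lemma mdeg_add: "mdeg (a + b) = mdeg a + mdeg b"
  by (rule poly_mapping_eqI) (simp add: lookup_mdeg lookup_add)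

lemma keys_mdeg: "keys (mdeg m) = keys m"
  by (auto simp: in_keys_iff lookup_mdeg)

text \<open>The shifts of a multigraded decomposition are integer vectors, possibly with negative
  entries, so the total degree is extended to them.\<close>

definition total :: "(nat \<Rightarrow>\<^sub>0 int) \<Rightarrow> int" where
  "total s = (\<Sum>i\<in>keys s. lookup s i)"

lemma total_add: "total (a + b) = total a + total b"
  unfolding total_def using setsum_keys_plus_distrib[of "\<lambda>_ e. e" a b] by simp

lemma total_diff: "total (a - b) = total a - total b"
  using total_add[of "a - b" b] by simp

lemma tdeg_eq_total: "tdeg m = total (mdeg m)"
  by (simp add: tdeg_def total_def keys_mdeg lookup_mdeg)

text \<open>The isomorphism that \<open>hilbert_dec\<close> only asserts to exist becomes a
  parameter, so that facts about it can be shared by the change of grading and the upper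
  bound.\<close>

locale direct_sum_iso =
  fixes deg :: "(nat \<Rightarrow>\<^sub>0 nat) \<Rightarrow> 'g::ab_group_add" and n :: nat
    and S :: "nat \<Rightarrow> 'k::field pol set" and s :: "nat \<Rightarrow> 'g" and L :: nat
    and M :: "'k pol set" and DS :: "(nat \<Rightarrow> 'k pol) set" and \<phi> :: "(nat \<Rightarrow> 'k pol) \<Rightarrow> 'k pol"
  assumes retract: "\<And>i. i < L \<Longrightarrow> graded_retract deg n (S i)"
    and DS_eq: "DS = {f. (\<forall>i<L. f i \<in> S i) \<and> (\<forall>i\<ge>L. f i = 0)}"
    and bij: "bij_betw \<phi> DS M"
    and add: "\<And>f h. f \<in> DS \<Longrightarrow> h \<in> DS \<Longrightarrow> \<phi> (\<lambda>i. f i + h i) = \<phi> f + \<phi> h"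
    and scale: "\<And>f c. f \<in> DS \<Longrightarrow> \<phi> (\<lambda>i. const c * f i) = const c * \<phi> f"
    and hom: "\<And>f g. f \<in> DS \<Longrightarrow> (\<And>i. i < L \<Longrightarrow> Defs.hom deg (g - s i) (f i)) \<Longrightarrow> Defs.hom deg g (\<phi> f)"
begin

lemma subalg: "i < L \<Longrightarrow> subalgebra n (S i)"
  and graded: "i < L \<Longrightarrow> graded_subspace deg (S i)"
  using retract by (auto simp: graded_retract_def)

lemma zero_DS: "(\<lambda>_. 0) \<in> DS"
  using subalgebra_zero[OF subalg] by (simp add: DS_eq)

lemma phi_zero: "\<phi> (\<lambda>_. 0) = 0"
  using scale[OF zero_DS, of 0] by simp

lemma scale_DS: "f \<in> DS \<Longrightarrow> (\<lambda>i. const c * f i) \<in> DS"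
  using subalgebra_mult[OF subalg] subalgebra_const[OF subalg] by (simp add: DS_eq)

lemma sum_DS: "(\<And>x. x \<in> X \<Longrightarrow> F x \<in> DS) \<Longrightarrow> (\<lambda>i. \<Sum>x\<in>X. F x i) \<in> DS"
  unfolding DS_eq by (auto intro!: subalgebra_sum[OF subalg])

lemma phi_sum: "(\<And>x. x \<in> X \<Longrightarrow> F x \<in> DS) \<Longrightarrow> \<phi> (\<lambda>i. \<Sum>x\<in>X. F x i) = (\<Sum>x\<in>X. \<phi> (F x))"
proof (induction X rule: infinite_finite_induct)
  case (insert x X)
  then have "\<phi> (\<lambda>i. F x i + (\<Sum>x\<in>X. F x i)) = \<phi> (F x) + \<phi> (\<lambda>i. \<Sum>x\<in>X. F x i)"
    by (intro add sum_DS) auto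
  then show ?case using insert by simp
qed (simp_all add: phi_zero)

lemma phi_in: "f \<in> DS \<Longrightarrow> \<phi> f \<in> M"
  using bij by (auto simp: bij_betw_def)

lemma phi_inj: "f \<in> DS \<Longrightarrow> h \<in> DS \<Longrightarrow> \<phi> f = \<phi> h \<Longrightarrow> f = h"
  using bij by (auto simp: bij_betw_def inj_on_def)

definition comp :: "'g \<Rightarrow> (nat \<Rightarrow> 'k pol) \<Rightarrow> nat \<Rightarrow> 'k pol" where
  "comp g f = (\<lambda>i. restr (\<lambda>m. deg m = g - s i) (f i))"

lemma comp_DS: "f \<in> DS \<Longrightarrow> comp g f \<in> DS"
  using graded_component[OF graded subalgebra_zero[OF subalg]] by (simp add: DS_eq comp_def)

text \<open>The assumption \<open>hom\<close> gives one direction only: homogeneous tuples have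
  homogeneous images. Splitting \<open>f\<close> into components yields images of distinct degrees,
  and restriction picks out the one of degree \<open>g\<close>.\<close>

lemma phi_component:
  assumes f: "f \<in> DS"
  shows "restr (\<lambda>m. deg m = g) (\<phi> f) = \<phi> (comp g f)"
proof -
  \<comment> \<open>\<open>g\<close> is inserted so that its component is a term of the sum even
    when it is zero.\<close>
  define G where "G = insert g (\<Union>i<L. (\<lambda>m. deg m + s i) ` keys (f i))"
  have fin: "finite G" by (simp add: G_def)
  have "f i = (\<Sum>h\<in>G. comp h f i)" for i
  proof (cases "i < L")
    case True
    then have "f i = (\<Sum>h\<in>G. restr (\<lambda>m. deg m + s i = h) (f i))"
      by (intro sum_components fin) (auto simp: G_def)
    then show ?thesis by (simp add: comp_def eq_diff_eq)
  next
    case False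
    then have "f i = 0" using f by (simp add: DS_eq)
    then show ?thesis by (simp add: comp_def)
  qed
  then have "f = (\<lambda>i. \<Sum>h\<in>G. comp h f i)" by auto
  then have "\<phi> f = (\<Sum>h\<in>G. \<phi> (comp h f))" using phi_sum[of G "\<lambda>h. comp h f"] comp_DS[OF f] by simp
  then have "restr (\<lambda>m. deg m = g) (\<phi> f) = (\<Sum>h\<in>G. restr (\<lambda>m. deg m = g) (\<phi> (comp h f)))"
    by (simp add: restr_sum)
  also have "\<dots> = (\<Sum>h\<in>G. if g = h then \<phi> (comp h f) else 0)"
  proof (rule sum.cong)
    fix h
    have "Defs.hom deg h (\<phi> (comp h f))"
      using comp_DS[OF f] by (intro hom) (auto simp: comp_def hom_restr)
    then show "restr (\<lambda>m. deg m = g) (\<phi> (comp h f)) = (if g = h then \<phi> (comp h f) else 0)"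
      by (rule hom_component)
  qed simp
  also have "\<dots> = \<phi> (comp g f)" using fin by (simp add: G_def)
  finally show ?thesis .
qed

end

section \<open>Conversions between the kinds of decomposition\<close>

lemma hilbert_dec_iff_iso:
  "hilbert_dec deg G n M D \<longleftrightarrow> (\<forall>i<length D. snd (D ! i) \<in> G) \<and>
    (\<exists>\<phi>. direct_sum_iso deg n (\<lambda>i. fst (D ! i)) (\<lambda>i. snd (D ! i)) (length D) M
      {f. (\<forall>i<length D. f i \<in> fst (D ! i)) \<and> (\<forall>i\<ge>length D. f i = 0)} \<phi>)"
  (is "_ \<longleftrightarrow> ?G \<and> (\<exists>\<phi>. direct_sum_iso deg n ?S ?s ?L M ?DS \<phi>)")
proof
  assume H: "hilbert_dec deg G n M D"
  obtain \<phi> where "bij_betw \<phi> ?DS M" "\<forall>f\<in>?DS. \<forall>h\<in>?DS. \<phi> (\<lambda>i. f i + h i) = \<phi> f + \<phi> h"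
    "\<forall>f\<in>?DS. \<forall>c. \<phi> (\<lambda>i. const c * f i) = const c * \<phi> f"
    "\<forall>f\<in>?DS. \<forall>g. (\<forall>i<?L. hom deg (g - ?s i) (f i)) \<longrightarrow> hom deg g (\<phi> f)"
    using H unfolding hilbert_dec_def Let_def by (elim conjE exE) (rule that)
  moreover have "\<forall>i<?L. graded_retract deg n (?S i)" and G: ?G
    using H by (simp_all add: hilbert_dec_def)
  ultimately have "direct_sum_iso deg n ?S ?s ?L M ?DS \<phi>" by unfold_locales simp_all
  with G show "?G \<and> (\<exists>\<phi>. direct_sum_iso deg n ?S ?s ?L M ?DS \<phi>)" by blast
next
  assume "?G \<and> (\<exists>\<phi>. direct_sum_iso deg n ?S ?s ?L M ?DS \<phi>)"
  then obtain \<phi> where G: ?G and "direct_sum_iso deg n ?S ?s ?L M ?DS \<phi>" by blast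
  then interpret direct_sum_iso deg n ?S ?s ?L M ?DS \<phi> by simp
  show "hilbert_dec deg G n M D" unfolding hilbert_dec_def Let_def
    by (intro conjI exI[of _ \<phi>] ballI allI impI retract bij add scale hom)
      (use G in \<open>simp_all del: mem_Collect_eq\<close>)
qed

text \<open>The same map serves. A monomial \<open>m\<close> of \<open>\<phi> f\<close> comes from
  the component of \<open>f\<close> in multidegree \<open>mdeg m\<close>, so some \<open>f i\<close>
  has a monomial of multidegree \<open>mdeg m\<close> minus the shift; comparing totals gives the
  degree of \<open>m\<close>.\<close>

lemma hilbert_dec_total:
  assumes "hilbert_dec mdeg G n M D"
  shows "hilbert_dec tdeg UNIV n M (map (\<lambda>(S, s). (S, total s)) D)"
proof -
  let ?S = "\<lambda>i. fst (D ! i)" and ?s = "\<lambda>i. snd (D ! i)" and ?L = "length D"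
  let ?DS = "{f. (\<forall>i<?L. f i \<in> ?S i) \<and> (\<forall>i\<ge>?L. f i = 0)}"
  let ?D = "map (\<lambda>(S, s). (S, total s)) D"
  obtain \<phi> where "direct_sum_iso mdeg n ?S ?s ?L M ?DS \<phi>"
    using assms by (auto simp: hilbert_dec_iff_iso)
  then interpret direct_sum_iso mdeg n ?S ?s ?L M ?DS \<phi> .
  have "Defs.hom tdeg g (\<phi> f)"
    if f: "f \<in> ?DS" and h: "\<And>i. i < ?L \<Longrightarrow> Defs.hom tdeg (g - total (?s i)) (f i)" for f g
    unfolding hom_def
  proof
    fix m assume m: "m \<in> keys (\<phi> f)"
    have "m \<in> keys (restr (\<lambda>m'. mdeg m' = mdeg m) (\<phi> f))" using m by (simp add: keys_restr)
    then have "\<phi> (comp (mdeg m) f) \<noteq> 0" by (auto simp: phi_component[OF f])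
    then have "comp (mdeg m) f \<noteq> (\<lambda>_. 0)" using phi_zero by auto
    then obtain i where i: "comp (mdeg m) f i \<noteq> 0" by auto
    then have "f i \<noteq> 0" by (auto simp: comp_def)
    then have iL: "i < ?L" using f by (force simp: not_le[symmetric])
    obtain m' where "m' \<in> keys (comp (mdeg m) f i)" using i by (metis keys_eq_empty ex_in_conv)
    then have m': "m' \<in> keys (f i)" "mdeg m' = mdeg m - ?s i" by (auto simp: comp_def keys_restr)
    then have "tdeg m' = tdeg m - total (?s i)" by (simp add: tdeg_eq_total total_diff)
    moreover have "tdeg m' = g - total (?s i)" using h[OF iL] m'(1) by (simp add: hom_def)
    ultimately show "tdeg m = g" by simp
  qed
  moreover have "graded_retract tdeg n (?S i)" if "i < ?L" for i
    using graded_retract_coarsen[OF retract[OF that]] tdeg_eq_total by blast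
  ultimately have "direct_sum_iso tdeg n ?S (\<lambda>i. total (?s i)) ?L M ?DS \<phi>"
    using bij add scale by unfold_locales auto
  moreover have "fst (?D ! i) = ?S i" "snd (?D ! i) = total (?s i)" if "i < ?L" for i
    using that by (simp_all add: case_prod_beta)
  ultimately show ?thesis unfolding hilbert_dec_iff_iso direct_sum_iso_def
    by (intro conjI exI[of _ \<phi>]) auto
qed

text \<open>The isomorphism sends \<open>f\<close> to the sum of the \<open>f i * x i\<close>,
  shifted by the multidegrees of the \<open>x i\<close>. Directness determines each product
  \<open>f i * x i\<close>, and \<open>x i\<close> cancels because the polynomial ring is a
  domain.\<close>

lemma stanley_dec_hilbert_dec:
  fixes D :: "('k::field pol set \<times> 'k pol) list"
  assumes D: "stanley_dec n M D" and M: "M \<subseteq> polyring n"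
  obtains D' where "hilbert_dec mdeg {s. keys s \<subseteq> {..<n}} n M D'" "map fst D' = map fst D"
proof -
  define L where "L = length D"
  define S where "S i = fst (D ! i)" for i
  define x where "x i = snd (D ! i)" for i
  have R: "graded_retract mdeg n (S i)" and xM: "x i \<in> M" and hx: "\<exists>g. hom mdeg g (x i)"
    and an: "S i \<inter> ann n (x i) = {0}" if "i < L" for i
    using D that by (auto simp: stanley_dec_def L_def S_def x_def)
  have M_eq: "M = {(\<Sum>i<L. f i * x i) | f. \<forall>i<L. f i \<in> S i}"
    using D by (auto simp: stanley_dec_def L_def S_def x_def)
  have uniq: "\<forall>i<L. f i * x i = h i * x i"
    if "\<forall>i<L. f i \<in> S i \<and> h i \<in> S i" "(\<Sum>i<L. f i * x i) = (\<Sum>i<L. h i * x i)" for f h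
    using D that by (auto simp: stanley_dec_def L_def S_def x_def)
  have subalg: "subalgebra n (S i)" if "i < L" for i using R[OF that] by (simp add: graded_retract_def)
  \<comment> \<open>For \<open>x i = 0\<close> the annihilator would contain 1, which also lies in
    \<open>S i\<close>.\<close>
  have x0: "x i \<noteq> 0" if "i < L" for i
  proof
    assume "x i = 0"
    then have "1 \<in> S i \<inter> ann n (x i)" using subalgebra_one[OF subalg[OF that]] subalg[OF that]
      by (auto simp: ann_def subalgebra_def)
    then show False using an[OF that] by simp
  qed
  \<comment> \<open>As \<open>x i\<close> is homogeneous, any of its monomials shows its
    multidegree.\<close>
  define k where "k i = (SOME m. m \<in> keys (x i))" for i
  have k: "k i \<in> keys (x i)" if "i < L" for i
    using x0[OF that] unfolding k_def by (simp add: some_in_eq)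
  define D' where "D' = map (\<lambda>i. (S i, mdeg (k i))) [0..<L]"
  have D': "fst (D' ! i) = S i" "snd (D' ! i) = mdeg (k i)" if "i < L" for i
    using that by (simp_all add: D'_def)
  have L': "length D' = L" by (simp add: D'_def)
  have hxk: "hom mdeg (mdeg (k i)) (x i)" if "i < L" for i
    using hx[OF that] k[OF that] by (auto simp: hom_def)
  define \<phi> where "\<phi> f = (\<Sum>i<L. f i * x i)" for f :: "nat \<Rightarrow> 'k pol"
  define DS where "DS = {f. (\<forall>i<L. f i \<in> S i) \<and> (\<forall>i\<ge>L. f i = 0)}"
  have iso: "direct_sum_iso mdeg n S (\<lambda>i. mdeg (k i)) L M DS \<phi>"
  proof
    have "inj_on \<phi> DS"
    proof (rule inj_onI)
      fix f h assume fh: "f \<in> DS" "h \<in> DS" "\<phi> f = \<phi> h"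
      then have "f i * x i = h i * x i" if "i < L" for i
        using uniq[of f h] that by (auto simp: \<phi>_def DS_def)
      then have "f i = h i" for i using x0[of i] fh by (cases "i < L") (auto simp: DS_def)
      then show "f = h" by auto
    qed
    moreover have "\<phi> ` DS = M"
    proof (intro equalityI subsetI)
      fix p assume "p \<in> M"
      then obtain f where f: "p = (\<Sum>i<L. f i * x i)" "\<forall>i<L. f i \<in> S i" using M_eq by blast
      let ?f = "\<lambda>i. if i < L then f i else 0"
      have "?f \<in> DS" using f by (simp add: DS_def)
      moreover have "\<phi> ?f = p" by (simp add: \<phi>_def f)
      ultimately show "p \<in> \<phi> ` DS" by blast
    qed (use M_eq in \<open>auto simp: \<phi>_def DS_def\<close>)
    ultimately show "bij_betw \<phi> DS M" by (simp add: bij_betw_def)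
    show "hom mdeg g (\<phi> f)"
      if f: "f \<in> DS" and h: "\<And>i. i < L \<Longrightarrow> hom mdeg (g - mdeg (k i)) (f i)" for f g
      unfolding hom_def
    proof
      fix m assume "m \<in> keys (\<phi> f)"
      then obtain i a b where i: "i < L" "a \<in> keys (f i)" "b \<in> keys (x i)" "m = a + b"
        unfolding \<phi>_def by (auto dest!: keys_sumD keys_multD)
      then have "mdeg a = g - mdeg (k i)" "mdeg b = mdeg (k i)"
        using h[OF i(1)] hxk[OF i(1)] by (auto simp: hom_def)
      then show "mdeg m = g" by (simp add: i mdeg_add)
    qed
  qed (use R in \<open>auto simp: DS_def \<phi>_def distrib_right sum.distrib sum_distrib_left mult.assoc\<close>)
  have "keys (mdeg (k i)) \<subseteq> {..<n}" if "i < L" for i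
    using k[OF that] xM[OF that] M by (auto simp: keys_mdeg polyring_def)
  then have "hilbert_dec mdeg {s. keys s \<subseteq> {..<n}} n M D'"
    unfolding hilbert_dec_iff_iso L' using iso D'
    by (intro conjI exI[of _ \<phi>]) (auto simp: direct_sum_iso_def DS_def)
  moreover have "map fst D' = map fst D"
    by (rule nth_equalityI) (auto simp: D'_def S_def L_def)
  ultimately show ?thesis using that by blast
qed

section \<open>A Stanley decomposition of the maximal ideal\<close>

definition sqfree :: "nat set \<Rightarrow> (nat \<Rightarrow>\<^sub>0 nat)" where
  "sqfree A = (\<Sum>i\<in>A. single i 1)"

lemma lookup_sqfree: "finite A \<Longrightarrow> lookup (sqfree A) i = (if i \<in> A then 1 else 0)"
  by (simp add: sqfree_def lookup_sum lookup_single when_def)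

lemma keys_sqfree: "finite A \<Longrightarrow> keys (sqfree A) = A"
  by (auto simp: in_keys_iff lookup_sqfree split: if_splits)

lemma keys_varring_mult_sqfree:
  assumes "f \<in> varring B" "finite A" "A \<subseteq> B" "m \<in> keys (f * single (sqfree A) 1)"
  shows "A \<subseteq> keys m" "keys m \<subseteq> B"
proof -
  obtain a where "a \<in> keys f" "m = a + sqfree A" using assms(4) by (auto dest!: keys_multD)
  then show "A \<subseteq> keys m" "keys m \<subseteq> B"
    using assms by (auto simp: keys_nat_add keys_sqfree varring_def)
qed

text \<open>Each monomial is divided by \<open>sqfree A\<close>. Because its support contains
  \<open>A\<close>, the truncated subtraction of exponents is exact.\<close>

lemma varring_mult_sqfree_surj:
  assumes "finite A" "\<And>m. m \<in> keys p \<Longrightarrow> A \<subseteq> keys m \<and> keys m \<subseteq> B"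
  shows "\<exists>f\<in>varring B. f * single (sqfree A) 1 = (p :: 'k::field pol)"
proof
  let ?f = "\<Sum>m\<in>keys p. single (m - sqfree A) (lookup p m)"
  show "?f \<in> varring B"
  proof (intro sum_in_varring single_in_varring)
    fix m assume m: "m \<in> keys p"
    have "keys (m - sqfree A) \<subseteq> keys m" by (auto simp: in_keys_iff lookup_minus)
    then show "keys (m - sqfree A) \<subseteq> B" using assms(2)[OF m] by blast
  qed
  have "m - sqfree A + sqfree A = m" if "m \<in> keys p" for m
    using assms(2)[OF that] assms(1)
    by (intro poly_mapping_eqI) (auto simp: lookup_add lookup_minus lookup_sqfree in_keys_iff subset_iff)
  then have "?f * single (sqfree A) 1 = (\<Sum>m\<in>keys p. single m (lookup p m))"
    unfolding sum_distrib_right by (intro sum.cong) (auto simp: mult_single)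
  then show "?f * single (sqfree A) 1 = p" using monomial_expansion[of p] by simp
qed

text \<open>The monomials of the ideal are those with nonempty support, so an interval partition of
  the supports splits them into blocks. Restriction to a block gives both existence and uniqueness
  of the summands.\<close>

lemma maxid_stanley_dec:
  assumes "n \<ge> 1"
  obtains D where "stanley_dec n (maxid n :: 'k::field pol set) D" "D \<noteq> []"
    "\<And>x. x \<in> set D \<Longrightarrow> (n + 1) div 2 \<le> krull_dim (fst x)"
proof -
  obtain F where fin: "finite F"
    and F: "\<And>A B. (A, B) \<in> F \<Longrightarrow> A \<noteq> {} \<and> A \<subseteq> B \<and> B \<subseteq> {..<n} \<and> (n + 1) div 2 \<le> card B"
    and ex: "\<And>C. C \<subseteq> {..<n} \<Longrightarrow> C \<noteq> {} \<Longrightarrow> \<exists>!I. I \<in> F \<and> fst I \<subseteq> C \<and> C \<subseteq> snd I"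
    using interval_partition[OF assms] by blast
  \<comment> \<open>An enumeration without repetition turns the unique interval of a support into a
    unique index.\<close>
  obtain Fs where Fs: "set Fs = F" "distinct Fs" using fin finite_distinct_list by blast
  define L where "L = length Fs"
  define A where "A i = fst (Fs ! i)" for i
  define B where "B i = snd (Fs ! i)" for i
  define X :: "nat \<Rightarrow> 'k pol" where "X i = single (sqfree (A i)) 1" for i
  define D where "D = map (\<lambda>i. (varring (B i) :: 'k pol set, X i)) [0..<L]"
  have LD: "length D = L" by (simp add: D_def)
  have nthD: "fst (D ! i) = varring (B i)" "snd (D ! i) = X i" if "i < L" for i
    using that by (simp_all add: D_def)
  have AB: "A i \<noteq> {}" "A i \<subseteq> B i" "B i \<subseteq> {..<n}" "(n + 1) div 2 \<le> card (B i)" if "i < L" for i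
    using F[of "A i" "B i"] that Fs(1) by (auto simp: A_def B_def L_def)
  have finA: "finite (A i)" if "i < L" for i using AB[OF that] by (meson finite_lessThan finite_subset)
  define between where "between i m \<longleftrightarrow> A i \<subseteq> keys m \<and> keys m \<subseteq> B i" for i and m :: "nat \<Rightarrow>\<^sub>0 nat"
  have between_ex: "\<exists>i<L. between i m" if m: "keys m \<subseteq> {..<n}" "m \<noteq> 0" for m
  proof -
    have "keys m \<noteq> {}" using m(2) by simp
    from ex[OF m(1) this] obtain I where I: "I \<in> F" "fst I \<subseteq> keys m" "keys m \<subseteq> snd I" by blast
    then obtain i where "i < L" "Fs ! i = I" using Fs(1) unfolding L_def by (metis in_set_conv_nth)
    then show ?thesis using I by (auto simp: between_def A_def B_def)
  qed
  have between_uniq: "i = j" if "i < L" "j < L" "between i m" "between j m" for i j m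
  proof -
    have "keys m \<subseteq> {..<n}" "keys m \<noteq> {}"
      using that(3) AB[OF that(1)] unfolding between_def by (blast, blast)
    then have "\<exists>!I. I \<in> F \<and> fst I \<subseteq> keys m \<and> keys m \<subseteq> snd I" by (rule ex)
    moreover have "Fs ! i \<in> F" "Fs ! j \<in> F" using that Fs(1) unfolding L_def by auto
    ultimately have "Fs ! i = Fs ! j" using that(3,4) unfolding between_def A_def B_def by blast
    then show ?thesis using that Fs(2) by (simp add: L_def nth_eq_iff_index_eq)
  qed
  have between_keys: "between i m" if "i < L" "f \<in> varring (B i)" "m \<in> keys (f * X i)" for i m f
    using keys_varring_mult_sqfree[OF that(2) finA[OF that(1)] AB(2)[OF that(1)]] that(3)
    by (auto simp: between_def X_def)
  \<comment> \<open>All monomials of the \<open>j\<close>-th summand lie in block \<open>j\<close>,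
    and the blocks are disjoint.\<close>
  have part: "restr (between i) (\<Sum>j<L. f j * X j) = f i * X i"
    if i: "i < L" and f: "\<forall>j<L. f j \<in> varring (B j)" for i f
  proof -
    have "restr (between i) (f j * X j) = (if i = j then f j * X j else 0)" if "j < L" for j
      using between_keys[OF that f[rule_format, OF that]] between_uniq[OF i that]
      by (auto intro!: restr_id restr_eq_0)
    then have "restr (between i) (\<Sum>j<L. f j * X j) = (\<Sum>j<L. if i = j then f j * X j else 0)"
      unfolding restr_sum by (intro sum.cong) auto
    then show ?thesis using i by simp
  qed
  have M: "maxid n = {(\<Sum>i<L. f i * X i) | f. \<forall>i<L. f i \<in> varring (B i)}" (is "_ = ?R")
  proof (intro equalityI subsetI)
    fix p :: "'k pol" assume p: "p \<in> maxid n"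
    have "\<exists>f. i < L \<longrightarrow> f \<in> varring (B i) \<and> f * X i = restr (between i) p" for i
      using varring_mult_sqfree_surj[OF finA, of i "restr (between i) p" "B i"]
      by (auto simp: X_def keys_restr between_def)
    then obtain f where f: "\<And>i. i < L \<Longrightarrow> f i \<in> varring (B i) \<and> f i * X i = restr (between i) p"
      by metis
    have "p = (\<Sum>i<L. restr (between i) p)"
    proof (rule poly_mapping_eqI)
      fix m
      show "lookup p m = lookup (\<Sum>i<L. restr (between i) p) m"
      proof (cases "m \<in> keys p")
        case True
        then have "keys m \<subseteq> {..<n}" "m \<noteq> 0" using p by (auto simp: maxid_eq varring_def)
        then obtain i where i: "i < L" "between i m" using between_ex by blast
        have "lookup (restr (between j) p) m = (if i = j then lookup p m else 0)" if "j < L" for j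
          using between_uniq[OF i(1) that i(2)] i(2) by (auto simp: lookup_restr)
        then have "(\<Sum>j<L. lookup (restr (between j) p) m) = (\<Sum>j<L. if i = j then lookup p m else 0)"
          by (intro sum.cong) auto
        then show ?thesis using i by (simp add: lookup_sum)
      next
        case False
        then have "lookup (restr (between i) p) m = 0" for i by (simp add: lookup_restr in_keys_iff)
        then show ?thesis using False by (simp add: lookup_sum in_keys_iff)
      qed
    qed
    also have "\<dots> = (\<Sum>i<L. f i * X i)" using f by (intro sum.cong) auto
    finally show "p \<in> ?R" using f by blast
  next
    fix p assume "p \<in> ?R"
    then obtain f where p: "p = (\<Sum>i<L. f i * X i)" and f: "\<forall>i<L. f i \<in> varring (B i)" by blast
    have "keys m \<subseteq> {..<n} \<and> m \<noteq> 0" if m: "m \<in> keys p" for m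
    proof -
      obtain i where "i < L" "m \<in> keys (f i * X i)" using m unfolding p by (auto dest: keys_sumD)
      then have "between i m" "i < L" using between_keys f by auto
      then show ?thesis using AB[of i] by (auto simp: between_def)
    qed
    then show "p \<in> maxid n" by (auto simp: maxid_eq varring_def)
  qed
  have X0: "X i \<noteq> 0" for i by (simp add: X_def flip: keys_eq_empty)
  have XM: "X i \<in> maxid n" if "i < L" for i
    using AB[OF that] keys_sqfree[OF finA[OF that]]
    by (auto simp: maxid_eq varring_def X_def)
  have sum_eq: "(\<Sum>i<L. f i * snd (D ! i)) = (\<Sum>i<L. f i * X i)" for f
    by (intro sum.cong) (auto simp: nthD)
  have "stanley_dec n (maxid n) D"
    unfolding stanley_dec_def LD
  proof (intro conjI allI impI)
    fix i assume i: "i < L"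
    show "graded_retract mdeg n (fst (D ! i))" using AB[OF i] i by (simp add: nthD graded_retract_varring)
    show "snd (D ! i) \<in> maxid n" using XM[OF i] i by (simp add: nthD)
    show "\<exists>g. hom mdeg g (snd (D ! i))" using i by (auto simp: nthD X_def hom_def)
    show "fst (D ! i) \<inter> ann n (snd (D ! i)) = {0}"
      using i X0 by (auto simp: nthD ann_def zero_in_varring polyring_eq_varring)
  next
    show "maxid n = {(\<Sum>i<L. f i * snd (D ! i)) | f. \<forall>i<L. f i \<in> fst (D ! i)}"
      using M by (simp add: nthD sum_eq)
  next
    fix f h i
    assume fh: "\<forall>i<L. f i \<in> fst (D ! i) \<and> h i \<in> fst (D ! i)"
      and eq: "(\<Sum>i<L. f i * snd (D ! i)) = (\<Sum>i<L. h i * snd (D ! i))" and i: "i < L"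
    have "(\<Sum>i<L. f i * X i) = (\<Sum>i<L. h i * X i)" using eq unfolding sum_eq .
    moreover have "restr (between i) (\<Sum>j<L. f j * X j) = f i * X i"
      "restr (between i) (\<Sum>j<L. h j * X j) = h i * X i"
      using fh by (intro part i; simp add: nthD)+
    ultimately have "f i * X i = h i * X i" by metis
    then show "f i * snd (D ! i) = h i * snd (D ! i)" unfolding nthD[OF i] .
  qed
  moreover have "D \<noteq> []"
  proof
    assume "D = []"
    then have "F = {}" using Fs by (simp add: D_def L_def)
    moreover have "{..<n} \<noteq> {}" using assms by (simp add: lessThan_empty_iff)
    ultimately show False using ex[OF order_refl] by blast
  qed
  moreover have "(n + 1) div 2 \<le> krull_dim (fst x)" if x: "x \<in> set D" for x
  proof -
    obtain i where i: "i < L" "x = (varring (B i), X i)" using x by (auto simp: D_def)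
    then show ?thesis using AB[OF i(1)] krull_dim_varring_ge[of "B i" n, where 'k='k] by simp
  qed
  ultimately show ?thesis using that by blast
qed

section \<open>The upper bound\<close>

text \<open>The pairs index the monomials of degree 2 in \<open>n\<close> variables.\<close>

lemma card_pairs: "2 * card {(i, j). i \<le> j \<and> j < (n::nat)} = n * (n + 1)"
proof -
  have "{(i, j). i \<le> j \<and> j < n} = prod.swap ` (SIGMA j:{..<n}. {..j})" by auto
  then have "card {(i, j). i \<le> j \<and> j < n} = (\<Sum>j<n. Suc j)"
    by (simp add: card_image)
  moreover have "2 * (\<Sum>j<n. Suc j) = n * (n + 1)" by (induction n) auto
  ultimately show ?thesis by simp
qed

lemma tdeg_eq_2:
  assumes "tdeg m = 2" "keys m \<subseteq> {..<n}"
  shows "m \<in> (\<lambda>(i, j). single i 1 + single j 1) ` {(i, j). i \<le> j \<and> j < n}"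
proof -
  have "m \<noteq> 0" using assms(1) by auto
  then obtain i m' where i: "i \<in> keys m" "m = single i 1 + m'" "tdeg m = 1 + tdeg m'" "keys m' \<subseteq> keys m"
    by (rule monomial_nonzeroE)
  then obtain j where j: "j \<in> keys m'" "m' = single j 1" using assms(1) tdeg_eq_1[of m'] by auto
  have "i < n" "j < n" using i j assms(2) by auto
  moreover have "m = single (min i j) 1 + single (max i j) 1"
    using i(2) j(2) by (auto simp: min_def max_def add.commute)
  ultimately show ?thesis by (intro image_eqI[of _ _ "(min i j, max i j)"]) auto
qed

context direct_sum_iso
begin

definition unit_at :: "nat \<Rightarrow> 'k pol \<Rightarrow> nat \<Rightarrow> 'k pol" where
  "unit_at i q = (\<lambda>j. if j = i then q else 0)"

lemma unit_at_DS: "i < L \<Longrightarrow> q \<in> S i \<Longrightarrow> unit_at i q \<in> DS"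
  using subalgebra_zero[OF subalg] by (auto simp: DS_eq unit_at_def)

lemma hom_phi_unit_at:
  assumes "i < L" "q \<in> S i" "Defs.hom deg g q"
  shows "Defs.hom deg (g + s i) (\<phi> (unit_at i q))"
  using assms by (intro hom unit_at_DS) (auto simp: unit_at_def hom_def)

lemma phi_combination:
  assumes "\<And>x. x \<in> X \<Longrightarrow> F x \<in> DS"
  shows "\<phi> (\<lambda>i. \<Sum>x\<in>X. const (c x) * F x i) = (\<Sum>x\<in>X. const (c x) * \<phi> (F x))"
  using phi_sum[of X "\<lambda>x i. const (c x) * F x i"] assms by (simp add: scale_DS scale)

end

lemma maxid_hilbert_dec_bound:
  fixes D :: "('k::field pol set \<times> int) list"
  assumes n: "n \<ge> 1" and D: "hilbert_dec tdeg UNIV n (maxid n) D"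
    and d: "\<And>x. x \<in> set D \<Longrightarrow> d \<le> krull_dim (fst x)"
  shows "d \<le> (n + 1) div 2"
proof -
  define S where "S i = fst (D ! i)" for i
  define s where "s i = snd (D ! i)" for i
  define L where "L = length D"
  define DS where "DS = {f. (\<forall>i<L. f i \<in> S i) \<and> (\<forall>i\<ge>L. f i = 0)}"
  obtain \<phi> where "direct_sum_iso tdeg n S s L (maxid n) DS \<phi>"
    using D unfolding hilbert_dec_iff_iso S_def s_def L_def DS_def by blast
  then interpret direct_sum_iso tdeg n S s L "maxid n" DS \<phi> .
  have "\<exists>B. i < L \<longrightarrow> finite B \<and> B \<subseteq> linear_forms (S i) \<and> \<not> pol.dependent B \<and> d \<le> card B" for i
  proof (cases "i < L")
    case True
    then have "S i \<subseteq> polyring n" using subalg by (simp add: subalgebra_def)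
    then obtain B where B: "finite B" "B \<subseteq> linear_forms (S i)" "\<not> pol.dependent B"
      "linear_forms (S i) \<subseteq> pol.span B" by (rule linear_forms_basis)
    have "d \<le> krull_dim (S i)" using d[of "D ! i"] True by (simp add: L_def S_def)
    also have "\<dots> \<le> card B" using krull_dim_le[OF retract[OF True] B(1,4)] .
    finally show ?thesis using B by blast
  qed simp
  then obtain B where B: "\<And>i. i < L \<Longrightarrow> finite (B i)" "\<And>i. i < L \<Longrightarrow> B i \<subseteq> linear_forms (S i)"
    "\<And>i. i < L \<Longrightarrow> \<not> pol.dependent (B i)" "\<And>i. i < L \<Longrightarrow> d \<le> card (B i)" by metis
  have one: "1 \<in> S i" if "i < L" for i using subalgebra_one[OF subalg[OF that]] .
  \<comment> \<open>The generator of a summand maps to a nonzero element of degree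
    \<open>s i\<close>, and the maximal ideal has no nonzero elements of degree 0 or less.\<close>
  have s_pos: "s i \<ge> 1" if i: "i < L" for i
  proof -
    have "unit_at i 1 \<noteq> (\<lambda>_. 0)" by (auto simp: unit_at_def fun_eq_iff)
    then have "\<phi> (unit_at i 1) \<noteq> 0"
      using phi_inj[OF unit_at_DS[OF i one[OF i]] zero_DS] phi_zero by auto
    then obtain m where m: "m \<in> keys (\<phi> (unit_at i 1))" by (metis keys_eq_empty ex_in_conv)
    have "m \<noteq> 0" using m phi_in[OF unit_at_DS[OF i one[OF i]]] by (auto simp: maxid_eq)
    moreover have "tdeg m = 0 + s i"
      using hom_phi_unit_at[OF i one[OF i], of 0] m by (auto simp: hom_def)
    ultimately show ?thesis using tdeg_nonneg[of m] tdeg_eq_0_iff[of m] by simp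
  qed
  define I where "I = {i. i < L \<and> s i = 1}"
  have finI: "finite I" by (simp add: I_def)
  \<comment> \<open>The variables lie in the span of the images of the generators in degree 1: a
    summand with shift 1 contributes only its constants to degree 1, one with larger shift
    contributes nothing.\<close>
  have "card {..<n} \<le> card ((\<lambda>i. \<phi> (unit_at i 1)) ` I)"
  proof (rule card_le_if_independent_family)
    show "Var ` {..<n} \<subseteq> pol.span ((\<lambda>i. \<phi> (unit_at i 1)) ` I)"
    proof clarify
      fix j assume j: "j < n"
      have "single j (1::nat) \<noteq> 0" by (simp flip: keys_eq_empty)
      then have "(Var j :: 'k pol) \<in> maxid n" using j by (auto simp: maxid_eq Var_def varring_def)
      then obtain f where f: "f \<in> DS" "\<phi> f = Var j"
        using bij unfolding bij_betw_def by (metis imageE)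
      define c where "c i = lookup (f i) 0" for i
      have "Var j = restr (\<lambda>m. tdeg m = 1) (\<phi> f)"
        unfolding f(2) by (rule restr_id[symmetric]) (simp add: Var_def)
      also have "\<dots> = \<phi> (comp 1 f)" by (rule phi_component[OF f(1)])
      also have "comp 1 f = (\<lambda>i. \<Sum>i'\<in>I. const (c i') * unit_at i' 1 i)"
      proof
        fix i
        have "(\<Sum>i'\<in>I. const (c i') * unit_at i' 1 i) = (\<Sum>i'\<in>I. if i = i' then const (c i') else 0)"
          by (intro sum.cong) (auto simp: unit_at_def)
        also have "\<dots> = (if i \<in> I then const (c i) else 0)" using finI by simp
        also have "\<dots> = comp 1 f i"
        proof (cases "i \<in> I")
          case True
          then have "comp 1 f i = restr (\<lambda>m. m = 0) (f i)" by (simp add: comp_def I_def tdeg_eq_0_iff)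
          also have "\<dots> = const (c i)"
            by (rule poly_mapping_eqI) (auto simp: lookup_restr const_def c_def lookup_single when_def)
          finally show ?thesis using True by simp
        next
          case False
          have "comp 1 f i = 0"
          proof (cases "i < L")
            case True
            then have "1 - s i < 0" using False s_pos[of i] by (auto simp: I_def)
            then have "tdeg m \<noteq> 1 - s i" for m using tdeg_nonneg[of m] by simp
            then show ?thesis by (simp add: comp_def restr_eq_0)
          next
            case False
            then show ?thesis using f(1) by (simp add: DS_def comp_def)
          qed
          then show ?thesis using False by simp
        qed
        finally show "comp 1 f i = (\<Sum>i'\<in>I. const (c i') * unit_at i' 1 i)" by simp
      qed
      also have "\<phi> \<dots> = (\<Sum>i\<in>I. const (c i) * \<phi> (unit_at i 1))"
        using one by (intro phi_combination unit_at_DS) (auto simp: I_def)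
      also have "\<dots> \<in> pol.span ((\<lambda>i. \<phi> (unit_at i 1)) ` I)"
        by (intro pol.span_sum pol.span_scale pol.span_base) auto
      finally show "Var j \<in> pol.span ((\<lambda>i. \<phi> (unit_at i 1)) ` I)" .
    qed
    fix u :: "nat \<Rightarrow> 'k" assume u: "(\<Sum>j<n. const (u j) * Var j) = 0"
    show "\<forall>j\<in>{..<n}. u j = 0"
    proof
      fix j assume j: "j \<in> {..<n}"
      have inj: "i = j" if "single i (Suc 0) = single j (Suc 0)" for i
        using arg_cong[OF that, of keys] by simp
      have "lookup (\<Sum>j<n. const (u j) * Var j) (single j 1) = (\<Sum>j'<n. if j = j' then u j' else 0)"
        unfolding lookup_sum
        by (intro sum.cong) (auto simp: lookup_const_mult Var_def lookup_single when_def dest: inj)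
      also have "\<dots> = u j" using j by simp
      finally show "u j = 0" using u by simp
    qed
  qed (use finI in auto)
  also have "\<dots> \<le> card I" using finI by (rule card_image_le)
  finally have nI: "n \<le> card I" by simp
  \<comment> \<open>Pairs of a summand with shift 1 and a basis element of its linear forms; their
    images are independent elements of degree 2.\<close>
  define J where "J = (SIGMA i:I. B i)"
  define v where "v = (\<lambda>(i, b). unit_at i b)"
  define X2 :: "(nat \<Rightarrow>\<^sub>0 nat) set"
    where "X2 = (\<lambda>(i, j). single i 1 + single j 1) ` {(i, j). i \<le> j \<and> j < n}"
  define T where "T = (\<lambda>m. single m (1::'k)) ` X2"
  have finP: "finite {(i, j). i \<le> j \<and> j < n}"
    by (rule finite_subset[of _ "{..<n} \<times> {..<n}"]) auto
  have finT: "finite T" using finP by (simp add: T_def X2_def)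
  have finJ: "finite J" unfolding J_def using finI B(1) by (intro finite_SigmaI) (auto simp: I_def)
  have bS: "b \<in> S i" "hom tdeg 1 b" if "i \<in> I" "b \<in> B i" for i b
    using B(2)[of i] that by (auto simp: I_def linear_forms_def)
  have vDS: "v x \<in> DS" if "x \<in> J" for x
    using that bS by (auto simp: J_def v_def I_def intro!: unit_at_DS)
  have "card J \<le> card T"
  proof (rule card_le_if_independent_family[OF finJ finT, of "\<lambda>x. \<phi> (v x)"])
    show "(\<lambda>x. \<phi> (v x)) ` J \<subseteq> pol.span T"
    proof clarify
      fix i b assume ib: "(i, b) \<in> J"
      then have i: "i \<in> I" "i < L" "s i = 1" and b: "b \<in> B i" by (auto simp: J_def I_def)
      have "hom tdeg (1 + s i) (\<phi> (v (i, b)))"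
        unfolding v_def using hom_phi_unit_at[OF i(2) bS[OF i(1) b]] by simp
      moreover have "\<phi> (v (i, b)) \<in> maxid n" using phi_in vDS[OF ib] by blast
      ultimately have "keys (\<phi> (v (i, b))) \<subseteq> X2"
        unfolding X2_def using i(3) by (intro subsetI tdeg_eq_2) (auto simp: hom_def maxid_eq varring_def)
      then show "\<phi> (v (i, b)) \<in> pol.span T" unfolding T_def by (rule span_monomials)
    qed
    fix u :: "nat \<times> 'k pol \<Rightarrow> 'k" assume u: "(\<Sum>x\<in>J. const (u x) * \<phi> (v x)) = 0"
    define w where "w = (\<lambda>i. \<Sum>x\<in>J. const (u x) * v x i)"
    have "w \<in> DS" unfolding w_def by (intro sum_DS scale_DS vDS)
    moreover have "\<phi> w = \<phi> (\<lambda>_. 0)"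
      using phi_combination[of J v u, OF vDS] u by (simp add: w_def phi_zero)
    ultimately have w: "w = (\<lambda>_. 0)" using phi_inj zero_DS by blast
    show "\<forall>x\<in>J. u x = 0"
    proof clarify
      fix i b assume "(i, b) \<in> J"
      then have i: "i \<in> I" "i < L" and b: "b \<in> B i" by (auto simp: J_def I_def)
      \<comment> \<open>The \<open>i\<close>-th coordinate of the vanishing combination is a
        relation among the independent forms in \<open>B i\<close>.\<close>
      have "w i = (\<Sum>i'\<in>I. \<Sum>b\<in>B i'. const (u (i', b)) * unit_at i' b i)"
        unfolding w_def J_def v_def using finI B(1)
        by (subst sum.Sigma) (auto simp: I_def case_prod_beta)
      also have "\<dots> = (\<Sum>i'\<in>I. if i = i' then \<Sum>b\<in>B i'. const (u (i', b)) * b else 0)"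
        by (intro sum.cong) (auto simp: unit_at_def)
      also have "\<dots> = (\<Sum>b\<in>B i. const (u (i, b)) * b)" using finI i by simp
      finally have "(\<Sum>b\<in>B i. const (u (i, b)) * b) = 0" using w by simp
      then show "u (i, b) = 0"
        using B(3)[OF i(2)] b pol.dependent_finite[OF B(1)[OF i(2)]] by auto
    qed
  qed
  also have "\<dots> \<le> card {(i, j). i \<le> j \<and> j < n}"
    unfolding T_def X2_def image_image using finP by (rule card_image_le)
  finally have "2 * card J \<le> n * (n + 1)" using card_pairs[of n] by simp
  moreover have "n * d \<le> card J"
  proof -
    have "n * d \<le> card I * d" using nI by simp
    also have "\<dots> = (\<Sum>i\<in>I. d)" by simp
    also have "\<dots> \<le> (\<Sum>i\<in>I. card (B i))" using B(4) by (intro sum_mono) (auto simp: I_def)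
    also have "\<dots> = card J" unfolding J_def using finI B(1) by (subst card_SigmaI) (auto simp: I_def)
    finally show ?thesis .
  qed
  ultimately have "n * (2 * d) \<le> n * (n + 1)" by simp
  then have "2 * d \<le> n + 1" using n by (simp only: mult_le_cancel1)
  then show ?thesis by simp
qed

section \<open>Comparison of the three depths\<close>

lemma dec_depth_cong: "map fst D = map fst D' \<Longrightarrow> dec_depth D \<delta> = dec_depth D' \<delta>"
  unfolding dec_depth_def by (metis image_image image_set)

lemma le_dec_depth_iff: "D \<noteq> [] \<Longrightarrow> k \<le> dec_depth D \<delta> \<longleftrightarrow> (\<forall>x\<in>set D. k \<le> \<delta> (fst x))"
  by (simp add: dec_depth_def)

lemma Sup_nat_eqI:
  fixes k :: nat
  assumes "x \<in> X" "k \<le> x" "\<And>y. y \<in> X \<Longrightarrow> y \<le> k"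
  shows "Sup X = k"
  using assms by (metis cSup_eq_maximum le_antisym)

theorem theorem3p1:
  fixes n :: nat
  assumes "n \<ge> 1"
  defines "m \<equiv> (maxid n :: 'k::field pol set)"
  shows "Hdepth_1 n m = Hdepth_n n m \<and> Hdepth_n n m = Stdepth_n n m \<and>
         Stdepth_n n m = (n + 1) div 2"
proof -
  let ?k = "(n + 1) div 2" and ?G = "{s :: nat \<Rightarrow>\<^sub>0 int. keys s \<subseteq> {..<n}}"
  have m: "m \<subseteq> polyring n" by (auto simp: m_def maxid_eq polyring_eq_varring)
  \<comment> \<open>Depth is preserved along the passage from Stanley to multigraded Hilbert to
    standard Hilbert decompositions. The lower bound travels forward along it, the upper bound
    backward.\<close>
  have St_H: "\<exists>D'. hilbert_dec mdeg ?G n m D' \<and> D' \<noteq> [] \<and> dec_depth D' krull_dim = dec_depth D krull_dim"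
    if D: "stanley_dec n m D" "D \<noteq> []" for D
  proof -
    obtain D' where D': "hilbert_dec mdeg ?G n m D'" "map fst D' = map fst D"
      using stanley_dec_hilbert_dec[OF D(1) m] .
    moreover have "D' \<noteq> []" using D'(2) D(2) by auto
    ultimately show ?thesis using dec_depth_cong[OF D'(2)] by (intro exI[of _ D'] conjI)
  qed
  have H_H: "\<exists>D'. hilbert_dec tdeg UNIV n m D' \<and> D' \<noteq> [] \<and> dec_depth D' krull_dim = dec_depth D krull_dim"
    if D: "hilbert_dec mdeg ?G n m D" "D \<noteq> []" for D
  proof -
    let ?D = "map (\<lambda>(S, s). (S, total s)) D"
    have "dec_depth ?D krull_dim = dec_depth D krull_dim" by (rule dec_depth_cong) auto
    moreover have "?D \<noteq> []" using D(2) by simp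
    ultimately show ?thesis using hilbert_dec_total[OF D(1)] by (intro exI[of _ ?D] conjI)
  qed
  have upper: "dec_depth D krull_dim \<le> ?k" if D: "hilbert_dec tdeg UNIV n m D" "D \<noteq> []" for D
  proof (rule maxid_hilbert_dec_bound[OF assms(1) D(1)[unfolded m_def]])
    show "dec_depth D krull_dim \<le> krull_dim (fst x)" if "x \<in> set D" for x
      using le_dec_depth_iff[OF D(2), of "dec_depth D krull_dim" krull_dim] that by simp
  qed
  obtain D0 :: "('k pol set \<times> 'k pol) list" where "stanley_dec n m D0" "D0 \<noteq> []"
    and "\<And>x. x \<in> set D0 \<Longrightarrow> ?k \<le> krull_dim (fst x)"
    using maxid_stanley_dec[OF assms(1)] unfolding m_def by blast
  then have D0: "stanley_dec n m D0" "D0 \<noteq> []" "?k \<le> dec_depth D0 krull_dim"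
    by (simp_all add: le_dec_depth_iff)
  obtain D1 where D1: "hilbert_dec mdeg ?G n m D1" "D1 \<noteq> []" "?k \<le> dec_depth D1 krull_dim"
    using St_H[OF D0(1,2)] D0(3) by auto
  obtain D2 where D2: "hilbert_dec tdeg UNIV n m D2" "D2 \<noteq> []" "?k \<le> dec_depth D2 krull_dim"
    using H_H[OF D1(1,2)] D1(3) by auto
  have upper': "dec_depth D krull_dim \<le> ?k" if "hilbert_dec mdeg ?G n m D" "D \<noteq> []" for D
    using H_H[OF that] upper by metis
  have upper'': "dec_depth D krull_dim \<le> ?k" if "stanley_dec n m D" "D \<noteq> []" for D
    using St_H[OF that] upper' by metis
  have "Hdepth_1 n m = ?k"
    unfolding Hdepth_1_def by (rule Sup_nat_eqI[OF _ D2(3)]) (use D2 upper in auto)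
  moreover have "Hdepth_n n m = ?k"
    unfolding Hdepth_n_def by (rule Sup_nat_eqI[OF _ D1(3)]) (use D1 upper' in auto)
  moreover have "Stdepth_n n m = ?k"
    unfolding Stdepth_n_def by (rule Sup_nat_eqI[OF _ D0(3)]) (use D0 upper'' in auto)
  ultimately show ?thesis by simp
qed

end
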